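(* If a consecution $X\vdash Y$ is valid, i.e. the formula $\Psi(X)\to\Upsilon(Y)$ is CBI-valid, then $X\vdash Y$ is provable in $\mathrm{DL}_{\mathrm{CBI}}$.
   Context: Models: a BBI-model is $\langle R,\circ,e\rangle$ with $e \in R$, $\circ : R\times R\to\mathcal{P}(R)$ commutative and associative (w.r.t. pointwise extension $X\circ Y=\bigcup_{x\in X,y\in Y}x\circ y$), $r\circ e=\{r\}$. A CBI-model is $\langle R,\circ,e,-,\infty\rangle$ with $\langle R,\circ,e\rangle$ a BBI-model, $-:R\to R$, $\infty\in R$, such that for each $x$, $-x$ is the unique element with $\infty\in x\circ(-x)$. CBI-formulas: $F ::= P \mid \top \mid \bot \mid \neg F \mid F\wedge F \mid F \vee F \mid F \to F \mid \top^* \mid \bot^* \mid \mathord{\sim} F \mid F * F \mid F \mathbin{\vee^*} F \mid F \mathrel{-\!\!*} F$, $P$ ranging over a countably infinite set $\mathcal{V}$. For an environment $\rho:\mathcal{V}\to\mathcal{P}(R)$: $r\models_\rho P$ iff $r\in\rho(P)$; $\top$ always; $\bot$ never; $\neg,\wedge,\vee,\to$ classically pointwise; $r\models_\rho\top^*$ iff $r=e$; $r\models_\rho\bot^*$ iff $r\neq\infty$; $r\models_\rho\mathord{\sim}F$ iff not $-r\models_\rho F$; $r\models_\rho F_1*F_2$ iff $\exists r_1,r_2$ with $r\in r_1\circ r_2$, $r_1\models_\rho F_1$, $r_2\models_\rho F_2$; $r\models_\rho F_1\mathbin{\vee^*}F_2$ iff for all $r_1,r_2$ with $-r\in r_1\circ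 r_2$, $-r_1\models_\rho F_1$ or $-r_2\models_\rho F_2$; $r\models_\rho F_1\mathrel{-\!\!*}F_2$ iff for all $r',r''$ with $r''\in r\circ r'$ and $r'\models_\rho F_1$, $r''\models_\rho F_2$. CBI-valid: satisfied by every element of every CBI-model under every environment. Structures: $X ::= F \mid \emptyset_a \mid \sharp X \mid X ; X \mid \emptyset_m \mid \flat X \mid X , X$; consecutions $X\vdash Y$. Define $\Psi,\Upsilon$ mutually: $\Psi(F)=\Upsilon(F)=F$; $\Psi(\emptyset_a)=\top$, $\Upsilon(\emptyset_a)=\bot$; $\Psi(\sharp X)=\neg\Upsilon(X)$, $\Upsilon(\sharp X)=\neg\Psi(X)$; $\Psi(X_1;X_2)=\Psi(X_1)\wedge\Psi(X_2)$, $\Upsilon(X_1;X_2)=\Upsilon(X_1)\vee\Upsilon(X_2)$; $\Psi(\emptyset_m)=\top^*$, $\Upsilon(\emptyset_m)=\bot^*$; $\Psi(\flat X)=\mathord{\sim}\Upsilon(X)$, $\Upsilon(\flat X)=\mathord{\sim}\Psi(X)$; $\Psi(X_1,X_2)=\Psi(X_1)*\Psi(X_2)$, $\Upsilon(X_1,X_2)=\Upsilon(X_1)\mathbin{\vee^*}\Upsilon(X_2)$. Display postulates (each line lists consecutions any two of which are interderivable): (1) $X;Y\vdash Z$, $X \vdash \sharp Y ; Z$, $Y;X\vdash Z$; (2) $X\vdash Y;Z$, $X;\sharp Y\vdash Z$, $X\vdash Z;Y$; (3) $X\vdash Y$, $\sharp Y\vdash \sharp X$, $\sharp\sharp X\vdash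 Y$; (4)–(6) the same with $,$ for $;$ and $\flat$ for $\sharp$. Display-equivalence: derivability using only display postulates. Rules of $\mathrm{DL}_{\mathrm{CBI}}$ (premises / conclusion): (Id) $P\vdash P$ for propositional variables $P$; (Cut) $X\vdash F$, $F\vdash Y$ / $X\vdash Y$; ($\equiv_D$) $X'\vdash Y'$ / $X\vdash Y$ when display-equivalent. Logical: $\emptyset_a\vdash X$ / $\top\vdash X$; axiom $\emptyset_a\vdash\top$; $\emptyset_m\vdash X$ / $\top^*\vdash X$; axiom $\emptyset_m\vdash\top^*$; axiom $\bot\vdash\emptyset_a$; $X\vdash\emptyset_a$ / $X\vdash\bot$; axiom $\bot^*\vdash\emptyset_m$; $X\vdash\emptyset_m$ / $X\vdash\bot^*$; $\sharp F\vdash X$ / $\neg F\vdash X$; $X\vdash\sharp F$ / $X\vdash\neg F$; $\flat F\vdash X$ / $\mathord{\sim}F\vdash X$; $X\vdash\flat F$ / $X\vdash\mathord{\sim}F$; $F;G\vdash X$ / $F\wedge G\vdash X$; $X\vdash F$, $Y\vdash G$ / $X;Y\vdash F\wedge G$; $F,G\vdash X$ / $F*G\vdash X$; $X\vdash F$, $Y\vdash G$ / $X,Y\vdash F*G$; $F\vdash X$, $G\vdash Y$ / $F\vee G\vdash X;Y$; $X\vdash F;G$ / $X\vdash F\vee G$; $F\vdash X$, $G\vdash Y$ / $F\mathbin{\vee^*}G\vdash X,Y$; $X\vdash F,G$ / $X\vdash F\mathbin{\vee^*}G$; $X\vdash F$, $G\vdash Y$ / $F\to G\vdash\sharp X;Y$;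 $X;F\vdash G$ / $X\vdash F\to G$; $X\vdash F$, $G\vdash Y$ / $F\mathrel{-\!\!*}G\vdash\flat X,Y$; $X,F\vdash G$ / $X\vdash F\mathrel{-\!\!*}G$. Structural (first eight bidirectional): $W;(X;Y)\vdash Z$ ⇔ $(W;X);Y\vdash Z$; $W\vdash(X;Y);Z$ ⇔ $W\vdash X;(Y;Z)$; same two with $,$; $\emptyset_a;X\vdash Y$ ⇔ $X\vdash Y$; $X\vdash Y;\emptyset_a$ ⇔ $X\vdash Y$; $\emptyset_m,X\vdash Y$ ⇔ $X\vdash Y$; $X\vdash Y,\emptyset_m$ ⇔ $X\vdash Y$; $X\vdash Z$ / $X;Y\vdash Z$; $X\vdash Z$ / $X\vdash Y;Z$; $X;X\vdash Z$ / $X\vdash Z$; $X\vdash Z;Z$ / $X\vdash Z$. *)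

theory Defs
  imports Main "HOL-Library.Countable_Set"
begin

section \<open>CBI-models\<close>

text \<open>A structure consists of a carrier set inside an ambient type together with operations that
  only matter on that carrier.\<close>

record 'r cbi_struct =
  worlds :: "'r set"
  mcomp :: "'r \<Rightarrow> 'r \<Rightarrow> 'r set"
  unit :: 'r
  dual :: "'r \<Rightarrow> 'r"
  infty :: 'r

definition set_comp :: "('r \<Rightarrow> 'r \<Rightarrow> 'r set) \<Rightarrow> 'r set \<Rightarrow> 'r set \<Rightarrow> 'r set" where
  "set_comp c X Y = (\<Union>x\<in>X. \<Union>y\<in>Y. c x y)"

definition bbi_model :: "'r set \<Rightarrow> ('r \<Rightarrow> 'r \<Rightarrow> 'r set) \<Rightarrow> 'r \<Rightarrow> bool" where
  "bbi_model R c e \<longleftrightarrow>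
     e \<in> R \<and>
     (\<forall>x\<in>R. \<forall>y\<in>R. c x y \<subseteq> R) \<and>
     (\<forall>x\<in>R. \<forall>y\<in>R. c x y = c y x) \<and>
     (\<forall>x\<in>R. \<forall>y\<in>R. \<forall>z\<in>R. set_comp c (c x y) {z} = set_comp c {x} (c y z)) \<and>
     (\<forall>x\<in>R. c x e = {x})"

definition cbi_model :: "'r cbi_struct \<Rightarrow> bool" where
  "cbi_model M \<longleftrightarrow>
     bbi_model (worlds M) (mcomp M) (unit M) \<and>
     infty M \<in> worlds M \<and>
     (\<forall>x\<in>worlds M. dual M x \<in> worlds M \<and> infty M \<in> mcomp M x (dual M x) \<and>
        (\<forall>y\<in>worlds M. infty M \<in> mcomp M x y \<longrightarrow> y = dual M x))"


section \<open>Formulas and validity\<close>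

datatype fm =
    Atom nat
  | Top
  | Bot
  | Neg fm
  | And fm fm
  | Or fm fm
  | Imp fm fm
  | MTop        \<comment> \<open>\<open>\<top>\<^sup>*\<close>\<close>
  | MBot        \<comment> \<open>\<open>\<bottom>\<^sup>*\<close>\<close>
  | MNeg fm     \<comment> \<open>\<open>\<sim>F\<close>\<close>
  | Star fm fm
  | Par fm fm   \<comment> \<open>\<open>F \<or>\<^sup>* G\<close>\<close>
  | Wand fm fm

instance fm :: countable
  by countable_datatype

primrec sat :: "'r cbi_struct \<Rightarrow> (nat \<Rightarrow> 'r set) \<Rightarrow> 'r \<Rightarrow> fm \<Rightarrow> bool" where
  "sat M \<rho> r (Atom p) \<longleftrightarrow> r \<in> \<rho> p"
| "sat M \<rho> r Top \<longleftrightarrow> True"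
| "sat M \<rho> r Bot \<longleftrightarrow> False"
| "sat M \<rho> r (Neg F) \<longleftrightarrow> \<not> sat M \<rho> r F"
| "sat M \<rho> r (And F G) \<longleftrightarrow> sat M \<rho> r F \<and> sat M \<rho> r G"
| "sat M \<rho> r (Or F G) \<longleftrightarrow> sat M \<rho> r F \<or> sat M \<rho> r G"
| "sat M \<rho> r (Imp F G) \<longleftrightarrow> (sat M \<rho> r F \<longrightarrow> sat M \<rho> r G)"
| "sat M \<rho> r MTop \<longleftrightarrow> r = unit M"
| "sat M \<rho> r MBot \<longleftrightarrow> r \<noteq> infty M"
| "sat M \<rho> r (MNeg F) \<longleftrightarrow> \<not> sat M \<rho> (dual M r) F"
| "sat M \<rho> r (Star F G) \<longleftrightarrow>
     (\<exists>r1\<in>worlds M. \<exists>r2\<in>worlds M. r \<in> mcomp M r1 r2 \<and> sat M \<rho> r1 F \<and> sat M \<rho> r2 G)"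
| "sat M \<rho> r (Par F G) \<longleftrightarrow>
     (\<forall>r1\<in>worlds M. \<forall>r2\<in>worlds M. dual M r \<in> mcomp M r1 r2 \<longrightarrow>
        sat M \<rho> (dual M r1) F \<or> sat M \<rho> (dual M r2) G)"
| "sat M \<rho> r (Wand F G) \<longleftrightarrow>
     (\<forall>r'\<in>worlds M. \<forall>r''\<in>worlds M. r'' \<in> mcomp M r r' \<and> sat M \<rho> r' F \<longrightarrow> sat M \<rho> r'' G)"

definition true_in :: "'r cbi_struct \<Rightarrow> fm \<Rightarrow> bool" where
  "true_in M F \<longleftrightarrow> (\<forall>\<rho>. (\<forall>p. \<rho> p \<subseteq> worlds M) \<longrightarrow> (\<forall>r\<in>worlds M. sat M \<rho> r F))"

text \<open>HOL cannot quantify over all types inside a definition, so models range over the subsets of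
  one fixed type of the cardinality of the continuum. This loses nothing: by the lemma
  \<open>cbi_valid_true_in\<close> below (a downward Loewenheim-Skolem argument), a formula that is valid in
  this sense is true in every CBI-model over every type.\<close>

definition cbi_valid :: "fm \<Rightarrow> bool" where
  "cbi_valid F \<longleftrightarrow> (\<forall>M :: fm set cbi_struct. cbi_model M \<longrightarrow> true_in M F)"


section \<open>Structures and consecutions\<close>

datatype struct =
    Fm fm
  | AEmpty                                  \<comment> \<open>\<open>\<emptyset>\<^sub>a\<close>\<close>
  | Sharp struct                            (\<open>\<sharp> _\<close> [80] 80)
  | Semi struct struct                      (infixr \<open>;;\<close> 70)
  | MEmpty                                  \<comment> \<open>\<open>\<emptyset>\<^sub>m\<close>\<close>
  | Flat struct                             (\<open>\<flat> _\<close> [80] 80)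
  | Comma struct struct                     (infixr \<open>,,\<close> 70)

datatype consecution = Consecution struct struct (infix \<open>\<turnstile>\<close> 60)

fun Psi :: "struct \<Rightarrow> fm" and Upsilon :: "struct \<Rightarrow> fm" where
  "Psi (Fm F) = F"
| "Psi AEmpty = Top"
| "Psi (\<sharp> X) = Neg (Upsilon X)"
| "Psi (X ;; Y) = And (Psi X) (Psi Y)"
| "Psi MEmpty = MTop"
| "Psi (\<flat> X) = MNeg (Upsilon X)"
| "Psi (X ,, Y) = Star (Psi X) (Psi Y)"
| "Upsilon (Fm F) = F"
| "Upsilon AEmpty = Bot"
| "Upsilon (\<sharp> X) = Neg (Psi X)"
| "Upsilon (X ;; Y) = Or (Upsilon X) (Upsilon Y)"
| "Upsilon MEmpty = MBot"
| "Upsilon (\<flat> X) = MNeg (Psi X)"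
| "Upsilon (X ,, Y) = Par (Upsilon X) (Upsilon Y)"

primrec consecution_valid :: "consecution \<Rightarrow> bool" where
  "consecution_valid (X \<turnstile> Y) \<longleftrightarrow> cbi_valid (Imp (Psi X) (Upsilon Y))"


section \<open>The display calculus\<close>

text \<open>Each display postulate lists three mutually interderivable consecutions; the first is linked
  to the other two here, and \<open>equivclp\<close> supplies the remaining directions.\<close>

inductive display_postulate :: "consecution \<Rightarrow> consecution \<Rightarrow> bool" where
  "display_postulate (X ;; Y \<turnstile> Z) (X \<turnstile> \<sharp> Y ;; Z)"
| "display_postulate (X ;; Y \<turnstile> Z) (Y ;; X \<turnstile> Z)"
| "display_postulate (X \<turnstile> Y ;; Z) (X ;; \<sharp> Y \<turnstile> Z)"
| "display_postulate (X \<turnstile> Y ;; Z) (X \<turnstile> Z ;; Y)"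
| "display_postulate (X \<turnstile> Y) (\<sharp> Y \<turnstile> \<sharp> X)"
| "display_postulate (X \<turnstile> Y) (\<sharp> \<sharp> X \<turnstile> Y)"
| "display_postulate (X ,, Y \<turnstile> Z) (X \<turnstile> \<flat> Y ,, Z)"
| "display_postulate (X ,, Y \<turnstile> Z) (Y ,, X \<turnstile> Z)"
| "display_postulate (X \<turnstile> Y ,, Z) (X ,, \<flat> Y \<turnstile> Z)"
| "display_postulate (X \<turnstile> Y ,, Z) (X \<turnstile> Z ,, Y)"
| "display_postulate (X \<turnstile> Y) (\<flat> Y \<turnstile> \<flat> X)"
| "display_postulate (X \<turnstile> Y) (\<flat> \<flat> X \<turnstile> Y)"

definition display_equiv :: "consecution \<Rightarrow> consecution \<Rightarrow> bool" (infix \<open>\<equiv>\<^sub>D\<close> 50) where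
  "display_equiv = equivclp display_postulate"

inductive provable :: "consecution \<Rightarrow> bool" where
  Id: "provable (Fm (Atom P) \<turnstile> Fm (Atom P))"
| Cut: "provable (X \<turnstile> Fm F) \<Longrightarrow> provable (Fm F \<turnstile> Y) \<Longrightarrow> provable (X \<turnstile> Y)"
| Disp: "provable (X' \<turnstile> Y') \<Longrightarrow> (X \<turnstile> Y) \<equiv>\<^sub>D (X' \<turnstile> Y') \<Longrightarrow> provable (X \<turnstile> Y)"
| TopL: "provable (AEmpty \<turnstile> X) \<Longrightarrow> provable (Fm Top \<turnstile> X)"
| TopR: "provable (AEmpty \<turnstile> Fm Top)"
| MTopL: "provable (MEmpty \<turnstile> X) \<Longrightarrow> provable (Fm MTop \<turnstile> X)"
| MTopR: "provable (MEmpty \<turnstile> Fm MTop)"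
| BotL: "provable (Fm Bot \<turnstile> AEmpty)"
| BotR: "provable (X \<turnstile> AEmpty) \<Longrightarrow> provable (X \<turnstile> Fm Bot)"
| MBotL: "provable (Fm MBot \<turnstile> MEmpty)"
| MBotR: "provable (X \<turnstile> MEmpty) \<Longrightarrow> provable (X \<turnstile> Fm MBot)"
| NegL: "provable (\<sharp> Fm F \<turnstile> X) \<Longrightarrow> provable (Fm (Neg F) \<turnstile> X)"
| NegR: "provable (X \<turnstile> \<sharp> Fm F) \<Longrightarrow> provable (X \<turnstile> Fm (Neg F))"
| MNegL: "provable (\<flat> Fm F \<turnstile> X) \<Longrightarrow> provable (Fm (MNeg F) \<turnstile> X)"
| MNegR: "provable (X \<turnstile> \<flat> Fm F) \<Longrightarrow> provable (X \<turnstile> Fm (MNeg F))"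
| AndL: "provable (Fm F ;; Fm G \<turnstile> X) \<Longrightarrow> provable (Fm (And F G) \<turnstile> X)"
| AndR: "provable (X \<turnstile> Fm F) \<Longrightarrow> provable (Y \<turnstile> Fm G) \<Longrightarrow> provable (X ;; Y \<turnstile> Fm (And F G))"
| StarL: "provable (Fm F ,, Fm G \<turnstile> X) \<Longrightarrow> provable (Fm (Star F G) \<turnstile> X)"
| StarR: "provable (X \<turnstile> Fm F) \<Longrightarrow> provable (Y \<turnstile> Fm G) \<Longrightarrow> provable (X ,, Y \<turnstile> Fm (Star F G))"
| OrL: "provable (Fm F \<turnstile> X) \<Longrightarrow> provable (Fm G \<turnstile> Y) \<Longrightarrow> provable (Fm (Or F G) \<turnstile> X ;; Y)"
| OrR: "provable (X \<turnstile> Fm F ;; Fm G) \<Longrightarrow> provable (X \<turnstile> Fm (Or F G))"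
| ParL: "provable (Fm F \<turnstile> X) \<Longrightarrow> provable (Fm G \<turnstile> Y) \<Longrightarrow> provable (Fm (Par F G) \<turnstile> X ,, Y)"
| ParR: "provable (X \<turnstile> Fm F ,, Fm G) \<Longrightarrow> provable (X \<turnstile> Fm (Par F G))"
| ImpL: "provable (X \<turnstile> Fm F) \<Longrightarrow> provable (Fm G \<turnstile> Y) \<Longrightarrow> provable (Fm (Imp F G) \<turnstile> \<sharp> X ;; Y)"
| ImpR: "provable (X ;; Fm F \<turnstile> Fm G) \<Longrightarrow> provable (X \<turnstile> Fm (Imp F G))"
| WandL: "provable (X \<turnstile> Fm F) \<Longrightarrow> provable (Fm G \<turnstile> Y) \<Longrightarrow> provable (Fm (Wand F G) \<turnstile> \<flat> X ,, Y)"
| WandR: "provable (X ,, Fm F \<turnstile> Fm G) \<Longrightarrow> provable (X \<turnstile> Fm (Wand F G))"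
| AAssocL1: "provable (W ;; (X ;; Y) \<turnstile> Z) \<Longrightarrow> provable ((W ;; X) ;; Y \<turnstile> Z)"
| AAssocL2: "provable ((W ;; X) ;; Y \<turnstile> Z) \<Longrightarrow> provable (W ;; (X ;; Y) \<turnstile> Z)"
| AAssocR1: "provable (W \<turnstile> (X ;; Y) ;; Z) \<Longrightarrow> provable (W \<turnstile> X ;; (Y ;; Z))"
| AAssocR2: "provable (W \<turnstile> X ;; (Y ;; Z)) \<Longrightarrow> provable (W \<turnstile> (X ;; Y) ;; Z)"
| MAssocL1: "provable (W ,, (X ,, Y) \<turnstile> Z) \<Longrightarrow> provable ((W ,, X) ,, Y \<turnstile> Z)"
| MAssocL2: "provable ((W ,, X) ,, Y \<turnstile> Z) \<Longrightarrow> provable (W ,, (X ,, Y) \<turnstile> Z)"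
| MAssocR1: "provable (W \<turnstile> (X ,, Y) ,, Z) \<Longrightarrow> provable (W \<turnstile> X ,, (Y ,, Z))"
| MAssocR2: "provable (W \<turnstile> X ,, (Y ,, Z)) \<Longrightarrow> provable (W \<turnstile> (X ,, Y) ,, Z)"
| AEmptyL1: "provable (AEmpty ;; X \<turnstile> Y) \<Longrightarrow> provable (X \<turnstile> Y)"
| AEmptyL2: "provable (X \<turnstile> Y) \<Longrightarrow> provable (AEmpty ;; X \<turnstile> Y)"
| AEmptyR1: "provable (X \<turnstile> Y ;; AEmpty) \<Longrightarrow> provable (X \<turnstile> Y)"
| AEmptyR2: "provable (X \<turnstile> Y) \<Longrightarrow> provable (X \<turnstile> Y ;; AEmpty)"
| MEmptyL1: "provable (MEmpty ,, X \<turnstile> Y) \<Longrightarrow> provable (X \<turnstile> Y)"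
| MEmptyL2: "provable (X \<turnstile> Y) \<Longrightarrow> provable (MEmpty ,, X \<turnstile> Y)"
| MEmptyR1: "provable (X \<turnstile> Y ,, MEmpty) \<Longrightarrow> provable (X \<turnstile> Y)"
| MEmptyR2: "provable (X \<turnstile> Y) \<Longrightarrow> provable (X \<turnstile> Y ,, MEmpty)"
| WeakL: "provable (X \<turnstile> Z) \<Longrightarrow> provable (X ;; Y \<turnstile> Z)"
| WeakR: "provable (X \<turnstile> Z) \<Longrightarrow> provable (X \<turnstile> Y ;; Z)"
| ContrL: "provable (X ;; X \<turnstile> Z) \<Longrightarrow> provable (X \<turnstile> Z)"
| ContrR: "provable (X \<turnstile> Z ;; Z) \<Longrightarrow> provable (X \<turnstile> Z)"


section \<open>Independence of validity from the ambient type\<close>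

lemma countable_witness_hull:
  fixes Q :: "'i::countable \<Rightarrow> 'r list \<Rightarrow> 'r \<Rightarrow> bool"
  assumes "countable B" "B \<subseteq> R" "B \<noteq> {}"
  obtains C where "countable C" "B \<subseteq> C" "C \<subseteq> R"
    "\<And>i xs v. set xs \<subseteq> C \<Longrightarrow> v \<in> R \<Longrightarrow> Q i xs v \<Longrightarrow> \<exists>v\<in>C. Q i xs v"
proof -
  obtain b where b: "b \<in> B" using assms(3) by blast
  define f where "f = (\<lambda>(i, xs). if \<exists>v\<in>R. Q i xs v then SOME v. v \<in> R \<and> Q i xs v else b)"
  define step where "step = (\<lambda>S. S \<union> f ` (UNIV \<times> lists S))"
  define S where "S n = (step ^^ n) B" for n
  have S0: "S 0 = B" and SS: "S (Suc n) = step (S n)" for n by (simp_all add: S_def)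
  have fR: "f p \<in> R" for p
  proof (cases p)
    case (Pair i xs)
    show ?thesis
    proof (cases "\<exists>v\<in>R. Q i xs v")
      case True
      then have "(SOME v. v \<in> R \<and> Q i xs v) \<in> R" by (metis (mono_tags, lifting) someI)
      with True Pair show ?thesis by (simp add: f_def)
    next
      case False
      with Pair b assms(2) show ?thesis by (auto simp: f_def)
    qed
  qed
  have cnt: "countable (S n)" for n
  proof (induction n)
    case 0
    then show ?case using assms by (simp add: S0)
  next
    case (Suc n)
    then show ?case by (auto simp: SS step_def intro!: countable_SIGMA)
  qed
  have sub: "S n \<subseteq> R" for n
    by (induction n) (use assms fR in \<open>auto simp: S0 SS step_def\<close>)
  have inc: "S m \<subseteq> S n" if "m \<le> n" for m n
    using that by (induction rule: dec_induct) (auto simp: SS step_def)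
  have fin: "\<exists>n. set xs \<subseteq> S n" if "set xs \<subseteq> (\<Union>n. S n)" for xs
    using that
  proof (induction xs)
    case (Cons x xs)
    then obtain m n where "x \<in> S m" "set xs \<subseteq> S n" by auto
    then have "set (x # xs) \<subseteq> S (max m n)"
      using inc[of m "max m n"] inc[of n "max m n"] by auto
    then show ?case ..
  qed simp
  show ?thesis
  proof (rule that[of "\<Union>n. S n"])
    show "countable (\<Union>n. S n)" using cnt by auto
    show "B \<subseteq> (\<Union>n. S n)" using S0 by blast
    show "(\<Union>n. S n) \<subseteq> R" using sub by blast
    fix i xs v
    assume "set xs \<subseteq> (\<Union>n. S n)" and v: "v \<in> R" "Q i xs v"
    then obtain n where n: "set xs \<subseteq> S n" using fin by blast
    then have "f (i, xs) \<in> S (Suc n)" by (auto simp: SS step_def intro!: imageI disjI2)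
    moreover have "Q i xs (f (i, xs))"
    proof -
      have "\<exists>v. v \<in> R \<and> Q i xs v" using v by blast
      then have "Q i xs (SOME v. v \<in> R \<and> Q i xs v)" by (metis (mono_tags, lifting) someI_ex)
      then show ?thesis using v by (auto simp: f_def)
    qed
    ultimately show "\<exists>v\<in>\<Union>n. S n. Q i xs v" by blast
  qed
qed

lemma set_comp_singletons:
  "w \<in> set_comp c A {z} \<longleftrightarrow> (\<exists>u\<in>A. w \<in> c u z)"
  "w \<in> set_comp c {x} A \<longleftrightarrow> (\<exists>u\<in>A. w \<in> c x u)"
  by (auto simp: set_comp_def)

lemma cbi_modelD:
  assumes "cbi_model M"
  shows "unit M \<in> worlds M" and "infty M \<in> worlds M"
    and "\<And>x y. x \<in> worlds M \<Longrightarrow> y \<in> worlds M \<Longrightarrow> mcomp M x y \<subseteq> worlds M"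
    and "\<And>x y. x \<in> worlds M \<Longrightarrow> y \<in> worlds M \<Longrightarrow> mcomp M x y = mcomp M y x"
    and "\<And>x y z. x \<in> worlds M \<Longrightarrow> y \<in> worlds M \<Longrightarrow> z \<in> worlds M \<Longrightarrow>
      set_comp (mcomp M) (mcomp M x y) {z} = set_comp (mcomp M) {x} (mcomp M y z)"
    and "\<And>x. x \<in> worlds M \<Longrightarrow> mcomp M x (unit M) = {x}"
    and "\<And>x. x \<in> worlds M \<Longrightarrow> dual M x \<in> worlds M"
    and "\<And>x. x \<in> worlds M \<Longrightarrow> infty M \<in> mcomp M x (dual M x)"
    and "\<And>x y. x \<in> worlds M \<Longrightarrow> y \<in> worlds M \<Longrightarrow> infty M \<in> mcomp M x y \<Longrightarrow> y = dual M x"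
  using assms unfolding cbi_model_def bbi_model_def by (elim conjE; metis)+

lemma countable_submodel:
  fixes M :: "'r cbi_struct"
  assumes M: "cbi_model M" and rho: "\<forall>p. \<rho> p \<subseteq> worlds M" and r0: "r0 \<in> worlds M"
  obtains N :: "'r cbi_struct" and \<rho>' where "cbi_model N" "countable (worlds N)"
    "\<forall>p. \<rho>' p \<subseteq> worlds N" "r0 \<in> worlds N" "\<And>F. sat N \<rho>' r0 F \<longleftrightarrow> sat M \<rho> r0 F"
proof -
  let ?R = "worlds M" and ?c = "mcomp M" and ?n = "dual M" and ?s = "sat M \<rho>"
  note eR = cbi_modelD(1)[OF M] and iR = cbi_modelD(2)[OF M] and cR = cbi_modelD(3)[OF M]
    and com = cbi_modelD(4)[OF M] and ass = cbi_modelD(5)[OF M] and un = cbi_modelD(6)[OF M]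
    and nR = cbi_modelD(7)[OF M] and n1 = cbi_modelD(8)[OF M] and n2 = cbi_modelD(9)[OF M]
  define Q :: "fm \<times> fm \<times> nat \<Rightarrow> 'r list \<Rightarrow> 'r \<Rightarrow> bool" where
    "Q = (\<lambda>(F, G, k) xs v.
       (k = 0 \<and> v = ?n (xs ! 0)) \<or>
       (k = 1 \<and> v \<in> ?c (xs ! 2) (xs ! 3) \<and> xs ! 0 \<in> ?c (xs ! 1) v) \<or>
       (k = 2 \<and> (\<exists>u\<in>?R. xs ! 0 \<in> ?c v u \<and> ?s v F \<and> ?s u G)) \<or>
       (k = 3 \<and> xs ! 0 \<in> ?c (xs ! 1) v \<and> ?s v G) \<or>
       (k = 4 \<and> (\<exists>u\<in>?R. ?n (xs ! 0) \<in> ?c v u \<and> \<not> ?s (?n v) F \<and> \<not> ?s (?n u) G)) \<or>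
       (k = 5 \<and> ?n (xs ! 0) \<in> ?c (xs ! 1) v \<and> \<not> ?s (?n v) G) \<or>
       (k = 6 \<and> (\<exists>u\<in>?R. u \<in> ?c (xs ! 0) v \<and> ?s v F \<and> \<not> ?s u G)) \<or>
       (k = 7 \<and> v \<in> ?c (xs ! 0) (xs ! 1) \<and> \<not> ?s v G))"
  obtain C where C: "countable C" "{unit M, infty M, r0} \<subseteq> C" "C \<subseteq> ?R"
    and wit: "\<And>i xs v. set xs \<subseteq> C \<Longrightarrow> v \<in> ?R \<Longrightarrow> Q i xs v \<Longrightarrow> \<exists>v\<in>C. Q i xs v"
    by (rule countable_witness_hull[of "{unit M, infty M, r0}" ?R Q])
      (use eR iR r0 in auto)
  have CR: "x \<in> ?R" if "x \<in> C" for x using that C by blast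
  have nC: "?n x \<in> C" if x: "x \<in> C" for x
  proof -
    have "\<exists>v\<in>C. Q (Top, Top, 0) [x] v"
      by (rule wit[of _ "?n x"]) (use x CR nR in \<open>auto simp: Q_def\<close>)
    then show ?thesis by (auto simp: Q_def)
  qed
  have aC: "\<exists>v\<in>C. v \<in> ?c y z \<and> w \<in> ?c x v"
    if "w \<in> C" "x \<in> C" "y \<in> C" "z \<in> C" "v \<in> ?c y z" "w \<in> ?c x v" for w x y z v
  proof -
    have "v \<in> ?R" using cR[OF CR CR] that by blast
    then have "\<exists>v\<in>C. Q (Top, Top, 1) [w, x, y, z] v"
      by (intro wit[of _ v]) (use that in \<open>auto simp: Q_def\<close>)
    then show ?thesis by (auto simp: Q_def numeral_2_eq_2 numeral_3_eq_3)
  qed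
  have starC: "\<exists>u\<in>C. \<exists>v\<in>C. r \<in> ?c u v \<and> ?s u F \<and> ?s v G"
    if r: "r \<in> C" and "u \<in> ?R" "v \<in> ?R" "r \<in> ?c u v" "?s u F" "?s v G" for r u v F G
  proof -
    have "\<exists>u\<in>C. Q (F, G, 2) [r] u"
      by (rule wit[of _ u]) (use that in \<open>auto simp: Q_def\<close>)
    then obtain u' v' where u': "u' \<in> C" "v' \<in> ?R" "r \<in> ?c u' v'" "?s u' F" "?s v' G"
      by (auto simp: Q_def)
    have "\<exists>v\<in>C. Q (F, G, 3) [r, u'] v"
      by (rule wit[of _ v']) (use u' r in \<open>auto simp: Q_def\<close>)
    then show ?thesis using u' by (auto simp: Q_def)
  qed
  have parC: "\<exists>u\<in>C. \<exists>v\<in>C. ?n r \<in> ?c u v \<and> \<not> ?s (?n u) F \<and> \<not> ?s (?n v) G"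
    if r: "r \<in> C" and "u \<in> ?R" "v \<in> ?R" "?n r \<in> ?c u v" "\<not> ?s (?n u) F" "\<not> ?s (?n v) G"
    for r u v F G
  proof -
    have "\<exists>u\<in>C. Q (F, G, 4) [r] u"
      by (rule wit[of _ u]) (use that in \<open>auto simp: Q_def\<close>)
    then obtain u' v' where u': "u' \<in> C" "v' \<in> ?R" "?n r \<in> ?c u' v'"
      "\<not> ?s (?n u') F" "\<not> ?s (?n v') G"
      by (auto simp: Q_def)
    have "\<exists>v\<in>C. Q (F, G, 5) [r, u'] v"
      by (rule wit[of _ v']) (use u' r in \<open>auto simp: Q_def\<close>)
    then show ?thesis using u' by (auto simp: Q_def)
  qed
  have wandC: "\<exists>u\<in>C. \<exists>v\<in>C. v \<in> ?c r u \<and> ?s u F \<and> \<not> ?s v G"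
    if r: "r \<in> C" and "u \<in> ?R" "v \<in> ?R" "v \<in> ?c r u" "?s u F" "\<not> ?s v G" for r u v F G
  proof -
    have "\<exists>u\<in>C. Q (F, G, 6) [r] u"
      by (rule wit[of _ u]) (use that in \<open>auto simp: Q_def\<close>)
    then obtain u' v' where u': "u' \<in> C" "v' \<in> ?R" "v' \<in> ?c r u'" "?s u' F" "\<not> ?s v' G"
      by (auto simp: Q_def)
    have "\<exists>v\<in>C. Q (F, G, 7) [r, u'] v"
      by (rule wit[of _ v']) (use u' r in \<open>auto simp: Q_def\<close>)
    then show ?thesis using u' by (auto simp: Q_def)
  qed
  define N where "N = M\<lparr>worlds := C, mcomp := \<lambda>x y. ?c x y \<inter> C\<rparr>"
  have N [simp]: "worlds N = C" "mcomp N = (\<lambda>x y. ?c x y \<inter> C)" "unit N = unit M"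
    "dual N = ?n" "infty N = infty M"
    by (simp_all add: N_def)
  have assN: "set_comp (mcomp N) (mcomp N x y) {z} = set_comp (mcomp N) {x} (mcomp N y z)"
    if xyz: "x \<in> C" "y \<in> C" "z \<in> C" for x y z
  proof (rule set_eqI)
    fix w
    have A: "set_comp ?c (?c x y) {z} = set_comp ?c {x} (?c y z)"
      using ass CR xyz by blast
    show "w \<in> set_comp (mcomp N) (mcomp N x y) {z} \<longleftrightarrow> w \<in> set_comp (mcomp N) {x} (mcomp N y z)"
    proof
      assume "w \<in> set_comp (mcomp N) (mcomp N x y) {z}"
      then have w: "w \<in> C" "w \<in> set_comp ?c (?c x y) {z}"
        by (auto simp: set_comp_singletons)
      then obtain u where "u \<in> ?c y z" "w \<in> ?c x u"
        unfolding A by (auto simp: set_comp_singletons)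
      then show "w \<in> set_comp (mcomp N) {x} (mcomp N y z)"
        using aC w xyz by (fastforce simp: set_comp_singletons)
    next
      assume "w \<in> set_comp (mcomp N) {x} (mcomp N y z)"
      then have w: "w \<in> C" "w \<in> set_comp ?c {x} (?c y z)"
        by (auto simp: set_comp_singletons)
      then obtain u where u: "u \<in> ?c x y" "w \<in> ?c u z"
        unfolding A[symmetric] by (auto simp: set_comp_singletons)
      then have "w \<in> ?c z u"
        using com cR[OF CR CR] CR xyz by blast
      then obtain v where v: "v \<in> C" "v \<in> ?c x y" "w \<in> ?c z v"
        using aC w xyz u by blast
      then have "w \<in> ?c v z" using com CR xyz by blast
      then show "w \<in> set_comp (mcomp N) (mcomp N x y) {z}"
        using v w by (auto simp: set_comp_singletons)
    qed
  qed
  have "bbi_model (worlds N) (mcomp N) (unit N)"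
    unfolding bbi_model_def
  proof (intro conjI ballI)
    fix x y z assume "x \<in> worlds N" "y \<in> worlds N" "z \<in> worlds N"
    then show "set_comp (mcomp N) (mcomp N x y) {z} = set_comp (mcomp N) {x} (mcomp N y z)"
      using assN by simp
  next
    fix x assume "x \<in> worlds N"
    then show "mcomp N x (unit N) = {x}" using un CR by auto
  next
    fix x y assume "x \<in> worlds N" "y \<in> worlds N"
    then show "mcomp N x y = mcomp N y x" using com CR by simp
  qed (use C in auto)
  then have model: "cbi_model N"
    unfolding cbi_model_def using C nC n1 n2 CR by simp
  define \<rho>' where "\<rho>' p = \<rho> p \<inter> C" for p
  have eq: "r \<in> C \<Longrightarrow> sat N \<rho>' r F \<longleftrightarrow> ?s r F" for r F
  proof (induction F arbitrary: r)
    case (Star F G)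
    have "sat N \<rho>' r (Star F G) \<longleftrightarrow> (\<exists>u\<in>C. \<exists>v\<in>C. r \<in> ?c u v \<and> ?s u F \<and> ?s v G)"
      using Star by auto
    also have "\<dots> \<longleftrightarrow> ?s r (Star F G)"
      using starC Star.prems CR by (simp; blast)
    finally show ?case .
  next
    case (Par F G)
    have "\<not> sat N \<rho>' r (Par F G) \<longleftrightarrow>
        (\<exists>u\<in>C. \<exists>v\<in>C. ?n r \<in> ?c u v \<and> \<not> ?s (?n u) F \<and> \<not> ?s (?n v) G)"
      using Par nC by auto
    also have "\<dots> \<longleftrightarrow> \<not> ?s r (Par F G)"
      using parC Par.prems CR by (simp; blast)
    finally show ?case by blast
  next
    case (Wand F G)
    have "\<not> sat N \<rho>' r (Wand F G) \<longleftrightarrow> (\<exists>u\<in>C. \<exists>v\<in>C. v \<in> ?c r u \<and> ?s u F \<and> \<not> ?s v G)"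
      using Wand by auto
    also have "\<dots> \<longleftrightarrow> \<not> ?s r (Wand F G)"
      using wandC Wand.prems CR by (simp; blast)
    finally show ?case by blast
  qed (auto simp: \<rho>'_def nC)
  show ?thesis
    by (rule that[of N \<rho>']) (use model C eq in \<open>auto simp: \<rho>'_def\<close>)
qed

lemma transport_model:
  fixes M :: "'r cbi_struct" and g :: "'r \<Rightarrow> 's"
  assumes M: "cbi_model M" and g: "inj_on g (worlds M)"
  obtains N :: "'s cbi_struct" where "cbi_model N" "worlds N = g ` worlds M"
    "\<And>\<rho> r F. \<forall>p. \<rho> p \<subseteq> worlds M \<Longrightarrow> r \<in> worlds M \<Longrightarrow>
       sat N (\<lambda>p. g ` \<rho> p) (g r) F \<longleftrightarrow> sat M \<rho> r F"
proof -
  let ?R = "worlds M" and ?c = "mcomp M" and ?n = "dual M"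
  note eR = cbi_modelD(1)[OF M] and iR = cbi_modelD(2)[OF M] and cR = cbi_modelD(3)[OF M]
    and com = cbi_modelD(4)[OF M] and ass = cbi_modelD(5)[OF M] and un = cbi_modelD(6)[OF M]
    and nR = cbi_modelD(7)[OF M] and n1 = cbi_modelD(8)[OF M] and n2 = cbi_modelD(9)[OF M]
  define h where "h = inv_into ?R g"
  have h: "h (g x) = x" if "x \<in> ?R" for x using that g by (simp add: h_def)
  have gi: "g x = g y \<longleftrightarrow> x = y" if "x \<in> ?R" "y \<in> ?R" for x y
    using that g by (auto dest: inj_onD)
  have gm: "g w \<in> g ` A \<longleftrightarrow> w \<in> A" if "w \<in> ?R" "A \<subseteq> ?R" for w A
    using that gi by blast
  define N where "N = \<lparr>worlds = g ` ?R, mcomp = \<lambda>a b. g ` ?c (h a) (h b), unit = g (unit M),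
    dual = \<lambda>a. g (?n (h a)), infty = g (infty M)\<rparr>"
  have N: "worlds N = g ` ?R" "unit N = g (unit M)" "infty N = g (infty M)"
    by (simp_all add: N_def)
  have Nc: "mcomp N (g x) (g y) = g ` ?c x y" if "x \<in> ?R" "y \<in> ?R" for x y
    using that h by (simp add: N_def)
  have Nn: "dual N (g x) = g (?n x)" if "x \<in> ?R" for x
    using that h by (simp add: N_def)
  have s1: "set_comp (mcomp N) (g ` A) {g z} = g ` set_comp ?c A {z}"
    if "A \<subseteq> ?R" "z \<in> ?R" for A z
  proof -
    have "mcomp N (g x) (g z) = g ` ?c x z" if "x \<in> A" for x
      using that Nc \<open>A \<subseteq> ?R\<close> \<open>z \<in> ?R\<close> by blast
    then show ?thesis by (auto simp: set_comp_def)
  qed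
  have s2: "set_comp (mcomp N) {g z} (g ` A) = g ` set_comp ?c {z} A"
    if "A \<subseteq> ?R" "z \<in> ?R" for A z
  proof -
    have "mcomp N (g z) (g x) = g ` ?c z x" if "x \<in> A" for x
      using that Nc \<open>A \<subseteq> ?R\<close> \<open>z \<in> ?R\<close> by blast
    then show ?thesis by (auto simp: set_comp_def)
  qed
  have "bbi_model (worlds N) (mcomp N) (unit N)"
    unfolding bbi_model_def N ball_simps
  proof (intro conjI ballI)
    show "g (unit M) \<in> g ` ?R" using eR by blast
  next
    fix x y assume "x \<in> ?R" "y \<in> ?R"
    then show "mcomp N (g x) (g y) \<subseteq> g ` ?R" using Nc cR by (simp add: image_mono)
  next
    fix x y assume "x \<in> ?R" "y \<in> ?R"
    then show "mcomp N (g x) (g y) = mcomp N (g y) (g x)" using Nc com by simp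
  next
    fix x y z assume "x \<in> ?R" "y \<in> ?R" "z \<in> ?R"
    then show "set_comp (mcomp N) (mcomp N (g x) (g y)) {g z}
        = set_comp (mcomp N) {g x} (mcomp N (g y) (g z))"
      using Nc s1 s2 cR ass by simp
  next
    fix x assume "x \<in> ?R"
    then show "mcomp N (g x) (g (unit M)) = {g x}" using Nc eR un by simp
  qed
  moreover have "\<forall>x\<in>?R. dual N (g x) \<in> g ` ?R \<and> g (infty M) \<in> mcomp N (g x) (dual N (g x)) \<and>
      (\<forall>y\<in>?R. g (infty M) \<in> mcomp N (g x) (g y) \<longrightarrow> g y = dual N (g x))"
    using Nc Nn nR n1 n2 gm iR cR by simp
  ultimately have model: "cbi_model N"
    unfolding cbi_model_def using iR by (simp add: N)
  have eq: "r \<in> ?R \<Longrightarrow> sat N (\<lambda>p. g ` \<rho> p) (g r) F \<longleftrightarrow> sat M \<rho> r F"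
    if rho: "\<forall>p. \<rho> p \<subseteq> ?R" for \<rho> :: "nat \<Rightarrow> 'r set" and r F
  proof (induction F arbitrary: r)
    case (Atom p)
    then show ?case using gm rho by simp
  next
    case (Star F G)
    then show ?case using cR by (simp add: N Nc gm)
  next
    case (Par F G)
    then show ?case using cR nR by (simp add: N Nc Nn gm)
  next
    case (Wand F G)
    then show ?case using cR by (simp add: N Nc gm)
  qed (use eR iR nR in \<open>auto simp: N Nn gi\<close>)
  show ?thesis
    by (rule that[of N]) (use model N eq in auto)
qed

lemma cbi_valid_true_in:
  fixes M :: "'r cbi_struct"
  assumes "cbi_valid F" "cbi_model M"
  shows "true_in M F"
  unfolding true_in_def
proof (intro allI impI ballI)
  fix \<rho> :: "nat \<Rightarrow> 'r set" and r assume "\<forall>p. \<rho> p \<subseteq> worlds M" "r \<in> worlds M"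
  then obtain N :: "'r cbi_struct" and \<rho>' where N: "cbi_model N" "countable (worlds N)"
    "\<forall>p. \<rho>' p \<subseteq> worlds N" "r \<in> worlds N" "\<And>F. sat N \<rho>' r F \<longleftrightarrow> sat M \<rho> r F"
    using countable_submodel[OF assms(2)] by metis
  define g where "g x = {Atom (to_nat_on (worlds N) x)}" for x
  have "inj_on g (worlds N)"
    using inj_on_to_nat_on[OF N(2)] by (auto simp: g_def inj_on_def)
  then obtain K :: "fm set cbi_struct" where K: "cbi_model K" "worlds K = g ` worlds N"
    "sat K (\<lambda>p. g ` \<rho>' p) (g r) F \<longleftrightarrow> sat N \<rho>' r F"
    using transport_model[OF N(1)] N(3,4) by metis
  have "true_in K F" using assms(1) K(1) by (simp add: cbi_valid_def)
  then have "sat K (\<lambda>p. g ` \<rho>' p) (g r) F"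
    using K(2) N(3,4) by (auto simp: true_in_def image_mono)
  then show "sat M \<rho> r F" using K(3) N(5) by simp
qed

end

theory Submission
  imports Defs
begin

text \<open>Canonical model construction. The worlds are the ultrafilters of the Lindenbaum algebra of
  the calculus, with \<open>z \<in> x \<circ> y\<close> iff \<open>A * B \<in> z\<close> for all \<open>A \<in> x\<close>, \<open>B \<in> y\<close>, and
  \<open>-x = {F. \<sim>F \<notin> x}\<close>. This frame satisfies all the model conditions except that several
  ultrafilters contain \<open>\<top>\<^sup>*\<close>. Every ultrafilter has exactly one of them as its unit, elements with
  a common composite have the same unit, and \<open>-\<close> preserves units; so the frame splits into
  components, each of which is a genuine CBI-model with \<open>\<infinity> = -e\<close>.\<close>

section \<open>Derived display rules\<close>

lemma provable_display_postulate:
  "display_postulate (X \<turnstile> Y) (X' \<turnstile> Y') \<Longrightarrow> provable (X \<turnstile> Y) \<longleftrightarrow> provable (X' \<turnstile> Y')"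
  by (metis Disp display_equiv_def equivclp_sym r_into_equivclp)

lemma display_semi_left: "provable (X ;; Y \<turnstile> Z) \<longleftrightarrow> provable (X \<turnstile> \<sharp> Y ;; Z)"
  and display_semi_left_comm: "provable (X ;; Y \<turnstile> Z) \<longleftrightarrow> provable (Y ;; X \<turnstile> Z)"
  and display_semi_right: "provable (X \<turnstile> Y ;; Z) \<longleftrightarrow> provable (X ;; \<sharp> Y \<turnstile> Z)"
  and display_semi_right_comm: "provable (X \<turnstile> Y ;; Z) \<longleftrightarrow> provable (X \<turnstile> Z ;; Y)"
  and display_sharp: "provable (X \<turnstile> Y) \<longleftrightarrow> provable (\<sharp> Y \<turnstile> \<sharp> X)"
  and display_comma_left: "provable (X ,, Y \<turnstile> Z) \<longleftrightarrow> provable (X \<turnstile> \<flat> Y ,, Z)"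
  and display_comma_left_comm: "provable (X ,, Y \<turnstile> Z) \<longleftrightarrow> provable (Y ,, X \<turnstile> Z)"
  and display_comma_right: "provable (X \<turnstile> Y ,, Z) \<longleftrightarrow> provable (X ,, \<flat> Y \<turnstile> Z)"
  and display_flat: "provable (X \<turnstile> Y) \<longleftrightarrow> provable (\<flat> Y \<turnstile> \<flat> X)"
  and display_flat_flat: "provable (X \<turnstile> Y) \<longleftrightarrow> provable (\<flat> \<flat> X \<turnstile> Y)"
  by (rule provable_display_postulate, rule display_postulate.intros)+

text \<open>\<open>Id\<close> covers atoms only; the left and right rules of each connective, with
  display moves between them, lift identity to compound formulas.\<close>

lemma provable_refl: "provable (Fm F \<turnstile> Fm F)"
proof (induction F)
  case (Imp F G)
  then show ?case using ImpL ImpR display_semi_left by blast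
next
  case (Wand F G)
  then show ?case using WandL WandR display_comma_left by blast
next
  case (Neg F)
  then show ?case using NegL NegR display_sharp by blast
next
  case (MNeg F)
  then show ?case using MNegL MNegR display_flat by blast
qed (blast intro: provable.intros)+

text \<open>The two halves need a joint induction because \<open>\<sharp>\<close> and
  \<open>\<flat>\<close> swap the two readings. Cuts against them reduce consecutions of structures
  to consecutions of formulas.\<close>

lemma provable_Psi_Upsilon:
  "provable (X \<turnstile> Fm (Psi X)) \<and> provable (Fm (Upsilon X) \<turnstile> X)"
proof (induction X)
  case (Sharp X)
  then show ?case using NegL NegR display_sharp by simp
next
  case (Flat X)
  then show ?case using MNegL MNegR display_flat by simp
qed (auto intro: provable.intros provable_refl)


section \<open>The Lindenbaum preorder\<close>

text \<open>The Lindenbaum algebra is handled through this preorder, without forming the quotient by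
  interderivability.\<close>

definition entails :: "fm \<Rightarrow> fm \<Rightarrow> bool" (infix \<open>\<preceq>\<close> 50) where
  "A \<preceq> B \<longleftrightarrow> provable (Fm A \<turnstile> Fm B)"

lemma provable_if_entails: "Psi X \<preceq> Upsilon Y \<Longrightarrow> provable (X \<turnstile> Y)"
  unfolding entails_def using provable_Psi_Upsilon Cut by blast

lemma entails_refl [simp]: "A \<preceq> A"
  by (simp add: entails_def provable_refl)

lemma entails_trans [trans]: "A \<preceq> B \<Longrightarrow> B \<preceq> C \<Longrightarrow> A \<preceq> C"
  unfolding entails_def by (rule Cut)

section \<open>Boolean structure of the preorder\<close>

lemma And_entails1: "And A B \<preceq> A"
  and And_entails2: "And A B \<preceq> B"
  unfolding entails_def using AndL WeakL display_semi_left_comm provable_refl by blast+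

lemma entails_And: "C \<preceq> A \<Longrightarrow> C \<preceq> B \<Longrightarrow> C \<preceq> And A B"
  unfolding entails_def using AndR ContrL by blast

lemma entails_Or1: "A \<preceq> Or A B"
  and entails_Or2: "B \<preceq> Or A B"
  unfolding entails_def using OrR WeakR display_semi_right_comm provable_refl by blast+

lemma Or_entails: "A \<preceq> C \<Longrightarrow> B \<preceq> C \<Longrightarrow> Or A B \<preceq> C"
  unfolding entails_def using OrL ContrR by blast

lemma entails_Top: "A \<preceq> Top"
  unfolding entails_def using AEmptyL1 WeakL TopR by blast

lemma Bot_entails: "Bot \<preceq> A"
  unfolding entails_def using AEmptyR1 WeakR BotL by blast

lemma And_Imp_entails: "And (Imp A B) A \<preceq> B"
  unfolding entails_def using AndL ImpL display_semi_left provable_refl by blast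

lemma And_mono: "A \<preceq> A' \<Longrightarrow> B \<preceq> B' \<Longrightarrow> And A B \<preceq> And A' B'"
  by (meson And_entails1 And_entails2 entails_And entails_trans)

lemma entails_Imp: "C \<preceq> Imp A B \<longleftrightarrow> And C A \<preceq> B"
proof
  assume "C \<preceq> Imp A B"
  then show "And C A \<preceq> B"
    by (meson And_Imp_entails And_mono entails_refl entails_trans)
next
  assume "And C A \<preceq> B"
  moreover have "provable (Fm C ;; Fm A \<turnstile> Fm (And C A))"
    by (simp add: AndR provable_refl)
  ultimately show "C \<preceq> Imp A B"
    unfolding entails_def using Cut ImpR by blast
qed

lemma And_Neg_entails: "And (Neg A) A \<preceq> Bot"
proof -
  have "provable (Fm (Neg A) \<turnstile> \<sharp> Fm A)"
    using NegL display_sharp provable_refl by blast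
  then show ?thesis
    unfolding entails_def using AEmptyR2 display_semi_left AndL BotR by blast
qed

text \<open>An antecedent \<open>AEmpty\<close> is carried along so that
  \<open>\<sharp> Fm A\<close> can be displayed away to the right as \<open>A\<close>; weakening
  then replaces \<open>AEmpty\<close> by \<open>C\<close>.\<close>

lemma entails_Or_Neg: "C \<preceq> Or A (Neg A)"
proof -
  have "provable (AEmpty ;; \<sharp> Fm A \<turnstile> Fm (Neg A))"
    using NegR AEmptyL2 display_sharp provable_refl by blast
  then have "provable (AEmpty \<turnstile> Fm (Or A (Neg A)))"
    using display_semi_right OrR by blast
  then show ?thesis
    unfolding entails_def using AEmptyL1 WeakL by blast
qed

section \<open>\<open>Star\<close> as a commutative monoid with residual \<open>Wand\<close>\<close>

lemma Star_mono: "A \<preceq> A' \<Longrightarrow> B \<preceq> B' \<Longrightarrow> Star A B \<preceq> Star A' B'"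
  unfolding entails_def by (intro StarL StarR)

lemma Star_comm: "Star A B \<preceq> Star B A"
  unfolding entails_def using StarL StarR display_comma_left_comm provable_refl by blast

lemma Star_entails: "Star A B \<preceq> C \<longleftrightarrow> provable (Fm A ,, Fm B \<turnstile> Fm C)"
  unfolding entails_def using StarL StarR Cut provable_refl by blast

lemma entails_Wand: "A \<preceq> Wand B C \<longleftrightarrow> Star A B \<preceq> C"
proof
  have "provable (Fm (Wand B C) ,, Fm B \<turnstile> Fm C)"
    using WandL display_comma_left provable_refl by blast
  then have "Star (Wand B C) B \<preceq> C"
    by (simp add: Star_entails)
  moreover assume "A \<preceq> Wand B C"
  ultimately show "Star A B \<preceq> C"
    by (meson Star_mono entails_refl entails_trans)
next
  assume "Star A B \<preceq> C"
  then show "A \<preceq> Wand B C"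
    using Star_entails WandR entails_def by blast
qed

text \<open>\<open>StarL\<close> applies only when the two formulas are the whole antecedent, so
  \<open>C\<close> is first moved to the right with \<open>WandR\<close>, and residuation brings it
  back.\<close>

lemma Star_assoc1: "Star (Star A B) C \<preceq> Star A (Star B C)"
proof -
  have "provable ((Fm A ,, Fm B) ,, Fm C \<turnstile> Fm (Star A (Star B C)))"
    by (intro MAssocL1 StarR provable_refl)
  then have "Star A B \<preceq> Wand C (Star A (Star B C))"
    by (simp add: WandR Star_entails)
  then show ?thesis by (simp add: entails_Wand)
qed

lemma Star_assoc2: "Star A (Star B C) \<preceq> Star (Star A B) C"
  by (meson Star_assoc1 Star_comm Star_mono entails_refl entails_trans)

lemma Star_MTop_entails: "Star A MTop \<preceq> A"
proof -
  have "provable (MEmpty \<turnstile> Fm (Wand A A))"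
    by (intro WandR MEmptyL2 provable_refl)
  then have "MTop \<preceq> Wand A A"
    by (simp add: entails_def MTopL)
  then show ?thesis
    by (meson Star_comm entails_Wand entails_trans)
qed

lemma entails_Star_MTop: "A \<preceq> Star A MTop"
proof -
  have "provable (MEmpty ,, Fm A \<turnstile> Fm (Star MTop A))"
    by (intro StarR MTopR provable_refl)
  then have "A \<preceq> Star MTop A"
    by (simp add: entails_def MEmptyL1)
  then show ?thesis
    by (meson Star_comm entails_trans)
qed

text \<open>A map with a right adjoint preserves joins; the adjoint here is
  \<open>Wand C\<close>.\<close>

lemma Star_Or_entails: "Star A C \<preceq> D \<Longrightarrow> Star B C \<preceq> D \<Longrightarrow> Star (Or A B) C \<preceq> D"
  by (simp add: entails_Wand[symmetric] Or_entails)

lemma Star_Bot_entails: "Star Bot A \<preceq> B"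
  by (simp add: entails_Wand[symmetric] Bot_entails)

section \<open>Multiplicative negation as an order-reversing involution\<close>

lemma provable_MBot: "provable (X \<turnstile> Fm MBot) \<longleftrightarrow> provable (X \<turnstile> MEmpty)"
  using MBotL MBotR Cut by blast

lemma provable_MNeg: "provable (X \<turnstile> Fm (MNeg A)) \<longleftrightarrow> provable (X \<turnstile> \<flat> Fm A)"
proof -
  have "provable (Fm (MNeg A) \<turnstile> \<flat> Fm A)"
    using MNegL display_flat provable_refl by blast
  then show ?thesis using MNegR Cut by blast
qed

lemma provable_flat: "provable (X \<turnstile> \<flat> Y) \<longleftrightarrow> provable (X ,, Y \<turnstile> MEmpty)"
  using MEmptyR1 MEmptyR2 display_comma_left by blast

text \<open>This makes \<open>MNeg B\<close> the residual of \<open>MBot\<close> by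
  \<open>B\<close>. Antitonicity and the unit of double negation follow from it alone.\<close>

lemma entails_MNeg: "A \<preceq> MNeg B \<longleftrightarrow> Star A B \<preceq> MBot"
  by (simp add: entails_def[of A] Star_entails provable_MBot provable_MNeg provable_flat)

lemma entails_MNeg_comm: "A \<preceq> MNeg B \<longleftrightarrow> B \<preceq> MNeg A"
  unfolding entails_MNeg by (meson Star_comm entails_trans)

lemma entails_MNeg_MNeg: "A \<preceq> MNeg (MNeg A)"
  using entails_MNeg_comm entails_refl by blast

text \<open>This half of the involution comes from the postulate that cancels a double
  \<open>\<flat>\<close>, not from residuation.\<close>

lemma MNeg_MNeg_entails: "MNeg (MNeg A) \<preceq> A"
proof -
  have "provable (\<flat> Fm A \<turnstile> Fm (MNeg A))"
    by (simp add: provable_MNeg display_flat[symmetric] provable_refl)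
  then have "provable (\<flat> Fm (MNeg A) \<turnstile> \<flat> \<flat> Fm A)"
    using display_flat by blast
  \<comment> \<open>The postulate cancels \<open>\<flat> \<flat>\<close> on the left; contraposing
    with \<open>display_flat\<close> before and after transfers this to the right.\<close>
  moreover have "provable (X \<turnstile> \<flat> \<flat> Y) \<longleftrightarrow> provable (X \<turnstile> Y)" for X Y
    using display_flat display_flat_flat by blast
  ultimately show ?thesis
    unfolding entails_def by (simp add: MNegL)
qed

lemma MNeg_antimono: "A \<preceq> B \<Longrightarrow> MNeg B \<preceq> MNeg A"
  by (meson entails_MNeg_MNeg entails_MNeg_comm entails_trans)

lemma Star_MNeg_entails: "Star (MNeg A) A \<preceq> MBot"
  using entails_MNeg entails_refl by blast

lemma MNeg_MTop_entails: "MNeg MTop \<preceq> MBot"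
  by (meson Star_MNeg_entails entails_Star_MTop entails_trans)

lemma MBot_entails_MNeg_MTop: "MBot \<preceq> MNeg MTop"
  by (simp add: entails_MNeg Star_MTop_entails)

lemma MNeg_Top_entails: "MNeg Top \<preceq> A"
  by (meson MNeg_MNeg_entails MNeg_antimono entails_Top Bot_entails entails_trans)

lemma entails_MNeg_Bot: "A \<preceq> MNeg Bot"
  using entails_MNeg_comm Bot_entails by blast

lemma MNeg_And_entails: "MNeg (And A B) \<preceq> Or (MNeg A) (MNeg B)"
proof -
  have "MNeg (Or (MNeg A) (MNeg B)) \<preceq> And A B"
    by (meson MNeg_MNeg_entails MNeg_antimono entails_And entails_Or1 entails_Or2 entails_trans)
  then show ?thesis
    by (meson MNeg_MNeg_entails MNeg_antimono entails_trans)
qed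

text \<open>By contraposition both \<open>A\<close> and \<open>Neg A\<close> lie below
  \<open>MNeg ?C\<close>, hence so does \<open>Top\<close>, and \<open>?C\<close> lies below
  \<open>MNeg Top\<close>, which is a least element.\<close>

lemma And_MNeg_Neg_entails: "And (MNeg A) (MNeg (Neg A)) \<preceq> Bot"
proof -
  let ?C = "And (MNeg A) (MNeg (Neg A))"
  have "Or A (Neg A) \<preceq> MNeg ?C"
    by (intro Or_entails) (simp_all add: entails_MNeg_comm[of _ ?C] And_entails1 And_entails2)
  then have "?C \<preceq> MNeg Top"
    by (meson entails_Or_Neg entails_trans entails_MNeg_comm)
  then show ?thesis
    by (meson MNeg_Top_entails entails_trans)
qed

section \<open>\<open>Par\<close> and \<open>Wand\<close> expressed by \<open>Star\<close> and
  \<open>MNeg\<close>\<close>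

lemma provable_Par: "provable (X \<turnstile> Fm (Par A B)) \<longleftrightarrow> provable (X \<turnstile> Fm A ,, Fm B)"
  using ParL ParR Cut provable_refl by blast

lemma entails_Par: "C \<preceq> Par A B \<longleftrightarrow> Star C (MNeg A) \<preceq> B"
proof -
  \<comment> \<open>\<open>MNegL\<close> needs the flat structure to be the whole antecedent, so it
    is displayed there before being replaced by the formula.\<close>
  have "provable (Fm C ,, \<flat> Fm A \<turnstile> Fm B) \<longleftrightarrow> provable (Fm C ,, Fm (MNeg A) \<turnstile> Fm B)"
  proof
    assume "provable (Fm C ,, \<flat> Fm A \<turnstile> Fm B)"
    then have "provable (\<flat> Fm A \<turnstile> \<flat> Fm C ,, Fm B)"
      using display_comma_left display_comma_left_comm by blast
    then have "provable (Fm (MNeg A) \<turnstile> \<flat> Fm C ,, Fm B)"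
      by (rule MNegL)
    then show "provable (Fm C ,, Fm (MNeg A) \<turnstile> Fm B)"
      using display_comma_left display_comma_left_comm by blast
  next
    assume "provable (Fm C ,, Fm (MNeg A) \<turnstile> Fm B)"
    then have "provable (Fm (MNeg A) \<turnstile> \<flat> Fm C ,, Fm B)"
      using display_comma_left display_comma_left_comm by blast
    moreover have "provable (\<flat> Fm A \<turnstile> Fm (MNeg A))"
      by (simp add: provable_MNeg display_flat[symmetric] provable_refl)
    ultimately have "provable (\<flat> Fm A \<turnstile> \<flat> Fm C ,, Fm B)"
      by (meson Cut)
    then show "provable (Fm C ,, \<flat> Fm A \<turnstile> Fm B)"
      using display_comma_left display_comma_left_comm by blast
  qed
  then show ?thesis
    by (simp add: entails_def[of C] provable_Par display_comma_right Star_entails)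
qed

text \<open>Rotation law: both sides say that the product of \<open>A\<close>, \<open>B\<close> and
  \<open>MNeg C\<close> lies below \<open>MBot\<close>, bracketed differently.\<close>

lemma Star_entails_iff: "Star A B \<preceq> C \<longleftrightarrow> A \<preceq> MNeg (Star B (MNeg C))"
proof -
  have "Star A B \<preceq> C \<longleftrightarrow> Star A B \<preceq> MNeg (MNeg C)"
    by (meson MNeg_MNeg_entails entails_MNeg_MNeg entails_trans)
  also have "\<dots> \<longleftrightarrow> Star A (Star B (MNeg C)) \<preceq> MBot"
    unfolding entails_MNeg by (meson Star_assoc1 Star_assoc2 entails_trans)
  finally show ?thesis by (simp add: entails_MNeg)
qed

lemma entails_Wand_MNeg: "MNeg (Star A (MNeg B)) \<preceq> Wand A B"
  using entails_Wand Star_entails_iff entails_refl by blast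

lemma Par_entails: "Par A B \<preceq> MNeg (Star (MNeg A) (MNeg B))"
  and entails_Par_MNeg: "MNeg (Star (MNeg A) (MNeg B)) \<preceq> Par A B"
  using entails_Par Star_entails_iff entails_refl by blast+


section \<open>Ultrafilters\<close>

definition fm_filter :: "fm set \<Rightarrow> bool" where
  "fm_filter S \<longleftrightarrow> Top \<in> S \<and> (\<forall>A\<in>S. \<forall>B. A \<preceq> B \<longrightarrow> B \<in> S) \<and> (\<forall>A\<in>S. \<forall>B\<in>S. And A B \<in> S)"

definition fm_ideal :: "fm set \<Rightarrow> bool" where
  "fm_ideal S \<longleftrightarrow> Bot \<in> S \<and> (\<forall>B\<in>S. \<forall>A. A \<preceq> B \<longrightarrow> A \<in> S) \<and> (\<forall>A\<in>S. \<forall>B\<in>S. Or A B \<in> S)"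

definition fm_ultra :: "fm set \<Rightarrow> bool" where
  "fm_ultra S \<longleftrightarrow> fm_filter S \<and> Bot \<notin> S \<and> (\<forall>A. A \<in> S \<or> Neg A \<in> S)"

lemma fm_ultra_filter: "fm_ultra x \<Longrightarrow> fm_filter x"
  by (simp add: fm_ultra_def)

lemma fm_filter_up: "fm_filter S \<Longrightarrow> A \<in> S \<Longrightarrow> A \<preceq> B \<Longrightarrow> B \<in> S"
  by (auto simp: fm_filter_def)

lemma fm_ultra_up: "fm_ultra S \<Longrightarrow> A \<in> S \<Longrightarrow> A \<preceq> B \<Longrightarrow> B \<in> S"
  using fm_filter_up fm_ultra_filter by blast

lemma fm_filter_principal: "fm_filter {B. A \<preceq> B}"
  unfolding fm_filter_def using entails_Top entails_trans entails_And by blast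

lemma fm_ideal_principal: "fm_ideal {B. B \<preceq> A}"
  unfolding fm_ideal_def using Bot_entails entails_trans Or_entails by blast

text \<open>These are the Boolean cases of the truth lemma \<open>sat_canon_model\<close>.\<close>

lemma fm_ultra_simps:
  assumes "fm_ultra x"
  shows "Top \<in> x" "Bot \<notin> x" "Neg A \<in> x \<longleftrightarrow> A \<notin> x" "And A B \<in> x \<longleftrightarrow> A \<in> x \<and> B \<in> x"
    "Or A B \<in> x \<longleftrightarrow> A \<in> x \<or> B \<in> x" "Imp A B \<in> x \<longleftrightarrow> (A \<in> x \<longrightarrow> B \<in> x)"
proof -
  note up = fm_ultra_up[OF assms]
  have conj: "And A B \<in> x" if "A \<in> x" "B \<in> x" for A B
    using assms that by (auto simp: fm_ultra_def fm_filter_def)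
  show "Top \<in> x" and bot: "Bot \<notin> x"
    using assms by (auto simp: fm_ultra_def fm_filter_def)
  have neg: "Neg A \<in> x \<longleftrightarrow> A \<notin> x" for A
    using assms conj up[OF _ And_Neg_entails] bot by (auto simp: fm_ultra_def)
  show "Neg A \<in> x \<longleftrightarrow> A \<notin> x" by (rule neg)
  show "And A B \<in> x \<longleftrightarrow> A \<in> x \<and> B \<in> x"
    using conj up And_entails1 And_entails2 by blast
  \<comment> \<open>This gives primeness: if \<open>A\<close> and \<open>B\<close> are both missing,
    their negations are present and exclude \<open>Or A B\<close>.\<close>
  have "And (Neg A) (Neg B) \<preceq> Imp (Or A B) Bot"
  proof -
    let ?C = "And (Neg A) (Neg B)"
    have "And A ?C \<preceq> Bot" "And B ?C \<preceq> Bot"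
      by (meson And_Neg_entails And_entails1 And_entails2 entails_And entails_trans)+
    then have "Or A B \<preceq> Imp ?C Bot"
      by (intro Or_entails) (simp_all add: entails_Imp)
    then show ?thesis
      unfolding entails_Imp by (meson And_entails1 And_entails2 entails_And entails_trans)
  qed
  then show "Or A B \<in> x \<longleftrightarrow> A \<in> x \<or> B \<in> x"
    using up conj bot neg entails_Or1 entails_Or2 And_Imp_entails by meson
  have "B \<preceq> Imp A B" "Neg A \<preceq> Imp A B"
    unfolding entails_Imp
    by (rule And_entails1, meson And_Neg_entails Bot_entails entails_trans)
  then show "Imp A B \<in> x \<longleftrightarrow> (A \<in> x \<longrightarrow> B \<in> x)"
    using up conj neg And_Imp_entails by meson
qed

lemma fm_ultra_subset_eq: "fm_ultra x \<Longrightarrow> fm_ultra y \<Longrightarrow> x \<subseteq> y \<Longrightarrow> x = y"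
  using fm_ultra_simps(3) by blast

lemma fm_filter_adjoin:
  assumes "fm_filter S"
  shows "fm_filter {B. \<exists>C\<in>S. And C A \<preceq> B}"
  unfolding fm_filter_def
proof (intro conjI ballI allI impI)
  show "Top \<in> {B. \<exists>C\<in>S. And C A \<preceq> B}"
    using assms entails_Top by (auto simp: fm_filter_def)
  fix B assume B: "B \<in> {B. \<exists>C\<in>S. And C A \<preceq> B}"
  show "B' \<in> {B. \<exists>C\<in>S. And C A \<preceq> B}" if "B \<preceq> B'" for B'
    using B that entails_trans by blast
  fix B' assume "B' \<in> {B. \<exists>C\<in>S. And C A \<preceq> B}"
  then obtain C C' where C: "C \<in> S" "C' \<in> S" "And C A \<preceq> B" "And C' A \<preceq> B'"
    using B by blast
  then have "And (And C C') A \<preceq> And B B'"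
    by (meson And_entails1 And_entails2 And_mono entails_And entails_refl entails_trans)
  moreover have "And C C' \<in> S" using assms C by (simp add: fm_filter_def)
  ultimately show "And B B' \<in> {B. \<exists>C\<in>S. And C A \<preceq> B}" by blast
qed

text \<open>Prime filter theorem: Zorn's lemma gives a maximal filter above \<open>S\<close> that
  avoids \<open>I\<close>, and maximality forces it to decide every formula.\<close>

lemma fm_ultra_extension:
  assumes S: "fm_filter S" and I: "fm_ideal I" and "S \<inter> I = {}"
  obtains x where "fm_ultra x" "S \<subseteq> x" "x \<inter> I = {}"
proof -
  define K where "K = {T. fm_filter T \<and> S \<subseteq> T \<and> T \<inter> I = {}}"
  have "\<exists>x\<in>K. \<forall>T\<in>K. x \<subseteq> T \<longrightarrow> T = x"
  proof (rule subset_Zorn_nonempty)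
    show "K \<noteq> {}" using assms by (auto simp: K_def)
    fix \<C> assume ne: "\<C> \<noteq> {}" and ch: "subset.chain K \<C>"
    have CK: "\<C> \<subseteq> K" and lin: "\<And>T U. T \<in> \<C> \<Longrightarrow> U \<in> \<C> \<Longrightarrow> T \<subseteq> U \<or> U \<subseteq> T"
      using ch by (auto simp: subset_chain_def)
    have "And A B \<in> \<Union>\<C>" if TU: "A \<in> T" "B \<in> U" "T \<in> \<C>" "U \<in> \<C>" for A B T U
    proof -
      obtain V where V: "V \<in> \<C>" "A \<in> V" "B \<in> V"
        using lin[OF TU(3,4)] TU by blast
      then have "fm_filter V" using CK by (auto simp: K_def)
      then have "And A B \<in> V" using V by (simp add: fm_filter_def)
      then show ?thesis using V by blast
    qed
    moreover obtain T where T: "T \<in> \<C>" using ne by blast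
    moreover have "Top \<in> T" "S \<subseteq> T" using T CK by (auto simp: K_def fm_filter_def)
    moreover have "B \<in> \<Union>\<C>" if "A \<in> \<Union>\<C>" "A \<preceq> B" for A B
    proof -
      obtain U where "U \<in> \<C>" "A \<in> U" using \<open>A \<in> \<Union>\<C>\<close> by blast
      moreover have "fm_filter U" using \<open>U \<in> \<C>\<close> CK by (auto simp: K_def)
      ultimately show ?thesis using fm_filter_up \<open>A \<preceq> B\<close> by blast
    qed
    ultimately have "fm_filter (\<Union>\<C>)" "S \<subseteq> \<Union>\<C>"
      unfolding fm_filter_def by blast+
    then show "\<Union>\<C> \<in> K" using CK unfolding K_def by blast
  qed
  then obtain x where xK: "x \<in> K" and max: "\<And>T. T \<in> K \<Longrightarrow> x \<subseteq> T \<Longrightarrow> T = x" by blast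
  have x: "fm_filter x" "S \<subseteq> x" "x \<inter> I = {}" using xK by (auto simp: K_def)
  \<comment> \<open>By maximality, adjoining a missing \<open>A\<close> must produce an element of
    \<open>I\<close>.\<close>
  have meet: "\<exists>C\<in>x. \<exists>D\<in>I. And C A \<preceq> D" if "A \<notin> x" for A
  proof (rule ccontr)
    assume not: "\<not> ?thesis"
    let ?T = "{B. \<exists>C\<in>x. And C A \<preceq> B}"
    have "x \<subseteq> ?T" using And_entails1 by blast
    moreover have "?T \<in> K"
      using x not calculation by (auto simp: K_def fm_filter_adjoin)
    moreover have "A \<in> ?T" using x(1) And_entails2 by (auto simp: fm_filter_def)
    ultimately show False using max that by blast
  qed
  have "A \<in> x \<or> Neg A \<in> x" for A
  proof (rule ccontr)
    assume "\<not> ?thesis"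
    then obtain C D C' D' where C: "C \<in> x" "D \<in> I" "And C A \<preceq> D"
      "C' \<in> x" "D' \<in> I" "And C' (Neg A) \<preceq> D'"
      using meet by meson
    \<comment> \<open>Bringing both refutations to the common pair \<open>?C\<close>,
      \<open>?D\<close> allows a case split on \<open>A\<close>; then \<open>?C\<close> in
      \<open>x\<close> lies below \<open>?D\<close> in \<open>I\<close>, a contradiction.\<close>
    let ?C = "And C C'" and ?D = "Or D D'"
    have "And A ?C \<preceq> And C A" "And (Neg A) ?C \<preceq> And C' (Neg A)"
      by (meson And_entails1 And_entails2 entails_And entails_trans)+
    then have "A \<preceq> Imp ?C ?D" "Neg A \<preceq> Imp ?C ?D"
      unfolding entails_Imp using C entails_trans entails_Or1 entails_Or2 by meson+
    then have "?C \<preceq> Imp ?C ?D"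
      using Or_entails entails_Or_Neg entails_trans by blast
    then have "?C \<preceq> ?D"
      unfolding entails_Imp using entails_And entails_refl entails_trans by blast
    moreover have "?C \<in> x" "?D \<in> I"
      using C x(1) I by (auto simp: fm_filter_def fm_ideal_def)
    ultimately show False using x fm_filter_up by blast
  qed
  moreover have "Bot \<notin> x" using x I by (auto simp: fm_ideal_def)
  ultimately have "fm_ultra x" using x(1) by (simp add: fm_ultra_def)
  then show ?thesis using that x by blast
qed


section \<open>The canonical frame\<close>

text \<open>Only the result is required to be an ultrafilter. The arguments may be mere filters, so
  factors can be enlarged to ultrafilters one at a time.\<close>

definition canon_comp :: "fm set \<Rightarrow> fm set \<Rightarrow> fm set set" where
  "canon_comp x y = {z. fm_ultra z \<and> (\<forall>A\<in>x. \<forall>B\<in>y. Star A B \<in> z)}"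

text \<open>This is the Routley star of \<open>x\<close> for the negation
  \<open>MNeg\<close>.\<close>

definition canon_dual :: "fm set \<Rightarrow> fm set" where
  "canon_dual x = {F. MNeg F \<notin> x}"

lemma canon_comp_comm: "canon_comp x y = canon_comp y x"
  unfolding canon_comp_def using Star_comm fm_ultra_up by blast

text \<open>The formulas that cannot belong to a left factor of \<open>z\<close> against
  \<open>D\<close> form an ideal disjoint from \<open>S\<close>; an ultrafilter above
  \<open>S\<close> avoiding it is as required. This is the source of all witnesses in the
  frame.\<close>

lemma fm_ultra_Star_extension:
  assumes S: "fm_filter S" and D: "fm_filter D" and z: "fm_ultra z"
    and Star: "\<And>A B. A \<in> S \<Longrightarrow> B \<in> D \<Longrightarrow> Star A B \<in> z"
  obtains x where "fm_ultra x" "S \<subseteq> x" "z \<in> canon_comp x D"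
proof -
  define I where "I = {A. \<exists>B\<in>D. Star A B \<notin> z}"
  have "Bot \<in> I"
    using D fm_ultra_simps(2)[OF z] fm_ultra_up[OF z _ Star_Bot_entails]
    by (auto simp: I_def fm_filter_def)
  moreover have "A' \<in> I" if "A \<in> I" "A' \<preceq> A" for A A'
    using that fm_ultra_up[OF z] Star_mono entails_refl unfolding I_def by blast
  moreover have "Or A A' \<in> I" if AA': "A \<in> I" "A' \<in> I" for A A'
  proof -
    obtain B B' where B: "B \<in> D" "B' \<in> D" "Star A B \<notin> z" "Star A' B' \<notin> z"
      using AA' by (auto simp: I_def)
    have "Star (Or A A') (And B B') \<preceq> Or (Star A B) (Star A' B')"
      by (meson And_entails1 And_entails2 Star_Or_entails Star_mono entails_Or1 entails_Or2
          entails_refl entails_trans)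
    then have "Star (Or A A') (And B B') \<notin> z"
      using B fm_ultra_up[OF z] fm_ultra_simps(5)[OF z] by blast
    moreover have "And B B' \<in> D" using B D by (simp add: fm_filter_def)
    ultimately show ?thesis by (auto simp: I_def)
  qed
  ultimately have "fm_ideal I" by (simp add: fm_ideal_def)
  moreover have "S \<inter> I = {}" using Star by (auto simp: I_def)
  ultimately obtain x where "fm_ultra x" "S \<subseteq> x" "x \<inter> I = {}"
    using fm_ultra_extension[OF S] by blast
  moreover have "z \<in> canon_comp x D"
    using \<open>x \<inter> I = {}\<close> z by (auto simp: I_def canon_comp_def)
  ultimately show ?thesis using that by blast
qed

text \<open>The principal filters of \<open>F\<close> and \<open>G\<close> are enlarged in turn, the
  second one against the ultrafilter already obtained from the first.\<close>

lemma fm_ultra_Star_witnesses: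
  assumes z: "fm_ultra z" and FG: "Star F G \<in> z"
  obtains x y where "fm_ultra x" "fm_ultra y" "F \<in> x" "G \<in> y" "z \<in> canon_comp x y"
proof -
  have "Star A B \<in> z" if "F \<preceq> A" "G \<preceq> B" for A B
    using that FG fm_ultra_up[OF z] Star_mono by blast
  then obtain x where x: "fm_ultra x" "{A. F \<preceq> A} \<subseteq> x" "z \<in> canon_comp x {B. G \<preceq> B}"
    using fm_ultra_Star_extension[OF fm_filter_principal fm_filter_principal z] by blast
  then have "Star B A \<in> z" if "B \<in> {B. G \<preceq> B}" "A \<in> x" for A B
    using that canon_comp_comm unfolding canon_comp_def by blast
  then obtain y where "fm_ultra y" "{B. G \<preceq> B} \<subseteq> y" "z \<in> canon_comp y x"
    using fm_ultra_Star_extension[OF fm_filter_principal fm_ultra_filter[OF x(1)] z] by blast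
  then show ?thesis using that x canon_comp_comm entails_refl by blast
qed

lemma canon_comp_assoc:
  assumes x: "fm_ultra x" and y: "fm_ultra y" and z: "fm_ultra z"
    and u: "u \<in> canon_comp x y" and w: "w \<in> canon_comp u z"
  obtains v where "v \<in> canon_comp y z" "w \<in> canon_comp x v"
proof -
  have wU: "fm_ultra w" using w by (simp add: canon_comp_def)
  \<comment> \<open>The filter generated by all products from \<open>y\<close> and \<open>z\<close>:
    every ultrafilter above it belongs to \<open>canon_comp y z\<close>.\<close>
  define S where "S = {E. \<exists>B\<in>y. \<exists>C\<in>z. Star B C \<preceq> E}"
  have "And E E' \<in> S" if EE': "E \<in> S" "E' \<in> S" for E E'
  proof -
    obtain B C B' C' where B: "B \<in> y" "C \<in> z" "B' \<in> y" "C' \<in> z" "Star B C \<preceq> E" "Star B' C' \<preceq> E'"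
      using EE' unfolding S_def by blast
    have "Star (And B B') (And C C') \<preceq> And E E'"
      by (meson B And_entails1 And_entails2 Star_mono entails_And entails_trans)
    then show ?thesis
      unfolding S_def using B fm_ultra_simps(4)[OF y] fm_ultra_simps(4)[OF z] by blast
  qed
  moreover have "Top \<in> S"
    using fm_ultra_simps(1)[OF y] fm_ultra_simps(1)[OF z] entails_Top unfolding S_def by blast
  moreover have "E' \<in> S" if "E \<in> S" "E \<preceq> E'" for E E'
    using that entails_trans unfolding S_def by blast
  ultimately have S: "fm_filter S" by (simp add: fm_filter_def)
  \<comment> \<open>The extension lemma enlarges the left factor, so \<open>E\<close> is put
    first.\<close>
  have "Star E A \<in> w" if EA: "E \<in> S" "A \<in> x" for E A
  proof -
    obtain B C where B: "B \<in> y" "C \<in> z" "Star B C \<preceq> E"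
      using EA unfolding S_def by blast
    have "Star (Star A B) C \<in> w"
      using u w B EA by (simp add: canon_comp_def)
    moreover have "Star (Star A B) C \<preceq> Star E A"
      by (meson B(3) Star_assoc1 Star_comm Star_mono entails_refl entails_trans)
    ultimately show ?thesis using fm_ultra_up[OF wU] by blast
  qed
  then obtain v where v: "fm_ultra v" "S \<subseteq> v" "w \<in> canon_comp v x"
    using fm_ultra_Star_extension[OF S fm_ultra_filter[OF x] wU] by blast
  then have "v \<in> canon_comp y z"
    unfolding canon_comp_def S_def using entails_refl by blast
  then show ?thesis using that v canon_comp_comm by blast
qed

lemma canon_comp_ultra: "z \<in> canon_comp x y \<Longrightarrow> fm_ultra z"
  by (simp add: canon_comp_def)

lemma canon_comp_assoc':
  assumes "fm_ultra x" "fm_ultra y" "fm_ultra z" "v \<in> canon_comp y z" "w \<in> canon_comp x v"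
  obtains u where "u \<in> canon_comp x y" "w \<in> canon_comp u z"
  using canon_comp_assoc[of z y x v w] assms canon_comp_comm by metis

section \<open>Units of the canonical frame\<close>

lemma canon_comp_unit:
  assumes x: "fm_ultra x" and e: "MTop \<in> e" and z: "z \<in> canon_comp x e"
  shows "z = x"
proof -
  have "x \<subseteq> z"
    using e z Star_MTop_entails fm_ultra_up unfolding canon_comp_def by blast
  then show ?thesis using fm_ultra_subset_eq x z canon_comp_ultra by blast
qed

lemma canon_unit_exists:
  assumes x: "fm_ultra x"
  obtains e where "fm_ultra e" "MTop \<in> e" "x \<in> canon_comp x e"
proof -
  have "Star B A \<in> x" if "B \<in> {B. MTop \<preceq> B}" "A \<in> x" for A B
    using that fm_ultra_up[OF x] entails_Star_MTop Star_mono Star_comm entails_refl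
    by (metis mem_Collect_eq)
  then obtain e where "fm_ultra e" "{B. MTop \<preceq> B} \<subseteq> e" "x \<in> canon_comp e x"
    using fm_ultra_Star_extension[OF fm_filter_principal fm_ultra_filter[OF x] x] by blast
  then show ?thesis using that canon_comp_comm entails_refl by blast
qed

text \<open>Reassociating \<open>x\<close> with both units yields a composite \<open>v\<close> of
  \<open>e\<close> and \<open>f\<close>; as each of them acts as a unit on the other,
  \<open>v\<close> equals both.\<close>

lemma canon_unit_unique:
  assumes x: "fm_ultra x" and e: "fm_ultra e" "MTop \<in> e" "x \<in> canon_comp x e"
    and f: "fm_ultra f" "MTop \<in> f" "x \<in> canon_comp x f"
  shows "e = f"
proof -
  obtain v where v: "v \<in> canon_comp e f"
    using canon_comp_assoc[OF x e(1) f(1) e(3) f(3)] by blast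
  then have "v = e" using canon_comp_unit e f by blast
  moreover have "v = f" using v canon_comp_unit e f canon_comp_comm by blast
  ultimately show ?thesis by simp
qed

section \<open>Duality of ultrafilters\<close>

lemma fm_ultra_canon_dual:
  assumes x: "fm_ultra x"
  shows "fm_ultra (canon_dual x)"
proof -
  note up = fm_ultra_up[OF x] and simps = fm_ultra_simps[OF x]
  have "MNeg Top \<notin> x" "MNeg Bot \<in> x"
    using up simps(1,2) MNeg_Top_entails entails_MNeg_Bot by blast+
  moreover have "MNeg B \<notin> x" if "MNeg A \<notin> x" "A \<preceq> B" for A B
    using that up MNeg_antimono by blast
  moreover have "MNeg (And A B) \<notin> x" if "MNeg A \<notin> x" "MNeg B \<notin> x" for A B
    using that up[OF _ MNeg_And_entails] simps(5) by blast
  \<comment> \<open>Read in \<open>canon_dual x\<close>, this says that every formula is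
    decided.\<close>
  moreover have "MNeg A \<notin> x \<or> MNeg (Neg A) \<notin> x" for A
    using up[OF _ And_MNeg_Neg_entails] simps by blast
  ultimately show ?thesis
    by (simp add: fm_ultra_def fm_filter_def canon_dual_def)
qed

text \<open>Frame counterpart of the rotation law \<open>Star_entails_iff\<close>. It yields both
  the composite with the dual and the counterexamples to \<open>Wand\<close>.\<close>

lemma canon_comp_rotate:
  assumes r: "fm_ultra r" and s: "fm_ultra s" and rs: "canon_dual r \<in> canon_comp x s"
  shows "canon_dual s \<in> canon_comp r x"
proof -
  have "MNeg (Star A B) \<notin> s" if "A \<in> r" "B \<in> x" for A B
  proof
    assume "MNeg (Star A B) \<in> s"
    then have "Star B (MNeg (Star A B)) \<in> canon_dual r"
      using rs that by (simp add: canon_comp_def)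
    moreover have "A \<preceq> MNeg (Star B (MNeg (Star A B)))"
      using Star_entails_iff entails_refl by blast
    ultimately show False
      using that fm_ultra_up[OF r] by (simp add: canon_dual_def)
  qed
  then show ?thesis
    using fm_ultra_canon_dual[OF s] by (simp add: canon_comp_def canon_dual_def)
qed

lemma canon_dual_dual:
  assumes "fm_ultra x"
  shows "canon_dual (canon_dual x) = x"
  unfolding canon_dual_def
  using fm_ultra_up[OF assms] MNeg_MNeg_entails entails_MNeg_MNeg by auto

lemma MBot_canon_dual: "fm_ultra e \<Longrightarrow> MTop \<in> e \<Longrightarrow> MBot \<notin> canon_dual e"
  using fm_ultra_up MBot_entails_MNeg_MTop entails_MNeg_comm unfolding canon_dual_def by blast

text \<open>Missing \<open>MBot\<close> stands in for being the point at infinity. If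
  \<open>G\<close> in \<open>y\<close> had \<open>MNeg G\<close> in \<open>x\<close>, their product
  would put \<open>MBot\<close> into \<open>w\<close>; maximality of ultrafilters does the
  rest.\<close>

lemma canon_dual_unique:
  assumes "fm_ultra x" "fm_ultra y" "w \<in> canon_comp x y" "MBot \<notin> w"
  shows "y = canon_dual x"
proof -
  have "MNeg G \<notin> x" if "G \<in> y" for G
    using that assms(3,4) Star_MNeg_entails fm_ultra_up unfolding canon_comp_def by blast
  then have "y \<subseteq> canon_dual x" by (auto simp: canon_dual_def)
  then show ?thesis
    using fm_ultra_subset_eq fm_ultra_canon_dual assms by blast
qed

lemma MTop_canon_dual:
  assumes "fm_ultra w" "MBot \<notin> w"
  shows "MTop \<in> canon_dual w"
  using assms fm_ultra_up MNeg_MTop_entails unfolding canon_dual_def by blast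


section \<open>Components of the canonical frame\<close>

text \<open>The component of the unit \<open>e\<close>. The operations need no restriction, because
  only their values on \<open>worlds\<close> matter.\<close>

definition canon_model :: "fm set \<Rightarrow> fm set cbi_struct" where
  "canon_model e = \<lparr>worlds = {x. fm_ultra x \<and> x \<in> canon_comp x e}, mcomp = canon_comp, unit = e,
     dual = canon_dual, infty = canon_dual e\<rparr>"

lemma canon_model_simps [simp]:
  "worlds (canon_model e) = {x. fm_ultra x \<and> x \<in> canon_comp x e}"
  "mcomp (canon_model e) = canon_comp" "unit (canon_model e) = e"
  "dual (canon_model e) = canon_dual" "infty (canon_model e) = canon_dual e"
  by (simp_all add: canon_model_def)

context
  fixes e assumes e: "fm_ultra e" "MTop \<in> e"
begin

text \<open>Reassociation moves the unit \<open>e\<close> from the factor \<open>y\<close> to the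
  composite.\<close>

lemma canon_comp_in_component:
  assumes "fm_ultra x" "fm_ultra y" "y \<in> canon_comp y e" "z \<in> canon_comp x y"
  shows "z \<in> canon_comp z e"
proof -
  obtain u where u: "u \<in> canon_comp x y" "z \<in> canon_comp u e"
    using canon_comp_assoc'[OF assms(1,2) e(1) assms(3,4)] by blast
  then show ?thesis using canon_comp_unit e canon_comp_ultra by blast
qed

text \<open>Some unit \<open>f\<close> of \<open>y\<close> exists and passes to the composite
  \<open>z\<close>, where uniqueness of units gives \<open>f = e\<close>. Witnesses found among all
  ultrafilters therefore stay in the component over which satisfaction quantifies.\<close>

lemma factor_in_component:
  assumes z: "z \<in> canon_comp z e" and x: "fm_ultra x" and y: "fm_ultra y" "z \<in> canon_comp x y"
  shows "y \<in> canon_comp y e"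
proof -
  obtain f where f: "fm_ultra f" "MTop \<in> f" "y \<in> canon_comp y f"
    using canon_unit_exists y by blast
  obtain u where u: "u \<in> canon_comp x y" "z \<in> canon_comp u f"
    using canon_comp_assoc'[OF x y(1) f(1,3) y(2)] by blast
  then have "z \<in> canon_comp z f"
    using canon_comp_unit f canon_comp_ultra by blast
  then have "e = f" using canon_unit_unique e f z canon_comp_ultra by blast
  then show ?thesis using f by simp
qed

lemma unit_in_component: "e \<in> canon_comp e e"
proof -
  obtain f where "fm_ultra f" "MTop \<in> f" "e \<in> canon_comp e f"
    using canon_unit_exists e by blast
  moreover have "e = f"
    using calculation canon_comp_unit[of f e e] e canon_comp_comm by auto
  ultimately show ?thesis by simp
qed

text \<open>The statement that \<open>e\<close> is a unit of \<open>x\<close>, with \<open>x\<close>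
  written as a double dual, rotates into this one.\<close>

lemma canon_dual_unit_in_comp:
  assumes x: "fm_ultra x" "x \<in> canon_comp x e"
  shows "canon_dual e \<in> canon_comp x (canon_dual x)"
proof -
  have "canon_dual (canon_dual x) \<in> canon_comp x e"
    using x canon_dual_dual by simp
  then have "canon_dual e \<in> canon_comp (canon_dual x) x"
    by (rule canon_comp_rotate[OF fm_ultra_canon_dual[OF x(1)] e(1)])
  then show ?thesis using canon_comp_comm by blast
qed

text \<open>The dual of \<open>e\<close> lies in the component, and \<open>canon_dual x\<close> is
  one of its factors.\<close>

lemma canon_dual_in_component:
  assumes x: "fm_ultra x" "x \<in> canon_comp x e"
  shows "canon_dual x \<in> canon_comp (canon_dual x) e"
proof -
  have "canon_dual e \<in> canon_comp e (canon_dual e)"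
    using canon_dual_unit_in_comp e unit_in_component by blast
  then have "canon_dual e \<in> canon_comp (canon_dual e) e"
    using canon_comp_comm by blast
  then show ?thesis
    using factor_in_component x fm_ultra_canon_dual canon_dual_unit_in_comp by blast
qed

lemma cbi_model_canon_model: "cbi_model (canon_model e)"
proof -
  let ?R = "worlds (canon_model e)"
  have "bbi_model ?R canon_comp e"
    unfolding bbi_model_def
  proof (intro conjI ballI)
    show "e \<in> ?R" using e unit_in_component by simp
  next
    fix x y assume "x \<in> ?R" "y \<in> ?R"
    then show "canon_comp x y \<subseteq> ?R"
      using canon_comp_in_component canon_comp_ultra by auto
  next
    fix x y show "canon_comp x y = canon_comp y x" by (rule canon_comp_comm)
  next
    fix x y z assume "x \<in> ?R" "y \<in> ?R" "z \<in> ?R"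
    then have "(\<exists>u\<in>canon_comp x y. w \<in> canon_comp u z) \<longleftrightarrow>
        (\<exists>v\<in>canon_comp y z. w \<in> canon_comp x v)" for w
      using canon_comp_assoc[of x y z _ w] canon_comp_assoc'[of x y z _ w] by auto metis+
    then show "set_comp canon_comp (canon_comp x y) {z} = set_comp canon_comp {x} (canon_comp y z)"
      by (auto simp: set_comp_def)
  next
    fix x assume "x \<in> ?R"
    then show "canon_comp x e = {x}" using canon_comp_unit e(2) by auto
  qed
  moreover have "canon_dual e \<in> ?R"
    using e unit_in_component canon_dual_in_component fm_ultra_canon_dual by simp
  moreover have "canon_dual x \<in> ?R \<and> canon_dual e \<in> canon_comp x (canon_dual x) \<and>
      (\<forall>y\<in>?R. canon_dual e \<in> canon_comp x y \<longrightarrow> y = canon_dual x)" if "x \<in> ?R" for x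
    using that canon_dual_in_component canon_dual_unit_in_comp fm_ultra_canon_dual
      canon_dual_unique MBot_canon_dual[OF e] by simp
  ultimately show ?thesis
    unfolding cbi_model_def by simp
qed

text \<open>Truth lemma. \<open>Star\<close> uses the ultrafilter witnesses directly;
  \<open>Par\<close> and \<open>Wand\<close> are reduced to a \<open>Star\<close> formula at
  \<open>canon_dual r\<close>.\<close>

lemma sat_canon_model:
  assumes "fm_ultra r" "r \<in> canon_comp r e"
  shows "sat (canon_model e) (\<lambda>p. {x \<in> worlds (canon_model e). Atom p \<in> x}) r F \<longleftrightarrow> F \<in> r"
  using assms
proof (induction F arbitrary: r)
  case MTop
  have "r = e" if "MTop \<in> r"
    using MTop that canon_comp_unit[of e r r] e canon_comp_comm by blast
  then show ?case using e by auto
next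
  case MBot
  \<comment> \<open>The dual of such an \<open>r\<close> contains \<open>MTop\<close> and has unit
    \<open>e\<close>, so it is \<open>e\<close> itself.\<close>
  have "r = canon_dual e" if r: "MBot \<notin> r"
  proof -
    have "canon_dual r = e"
      using MTop_canon_dual[OF MBot(1) r] canon_dual_in_component[OF MBot]
        canon_comp_unit[of e "canon_dual r" "canon_dual r"] e fm_ultra_canon_dual[OF MBot(1)]
        canon_comp_comm by blast
    then show ?thesis using canon_dual_dual MBot by blast
  qed
  then show ?case using MBot_canon_dual e by auto
next
  case (MNeg F)
  then show ?case
    using canon_dual_in_component fm_ultra_canon_dual by (simp add: canon_dual_def)
next
  case (Star F G)
  have "(\<exists>x y. fm_ultra x \<and> x \<in> canon_comp x e \<and> fm_ultra y \<and> y \<in> canon_comp y e \<and>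
      r \<in> canon_comp x y \<and> F \<in> x \<and> G \<in> y) \<longleftrightarrow> Star F G \<in> r" (is "?L \<longleftrightarrow> _")
  proof
    assume "Star F G \<in> r"
    then obtain x y where "fm_ultra x" "fm_ultra y" "F \<in> x" "G \<in> y" "r \<in> canon_comp x y"
      using fm_ultra_Star_witnesses Star.prems by blast
    then show ?L using factor_in_component Star.prems canon_comp_comm by metis
  qed (auto simp: canon_comp_def)
  then show ?case using Star by auto
next
  case (Par F G)
  have dual: "fm_ultra (canon_dual r)" "canon_dual r \<in> canon_comp (canon_dual r) e"
    using Par.prems fm_ultra_canon_dual canon_dual_in_component by blast+
  have "Par F G \<in> r \<longleftrightarrow> Star (MNeg F) (MNeg G) \<notin> canon_dual r"
    using fm_ultra_up[OF Par.prems(1)] Par_entails entails_Par_MNeg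
    unfolding canon_dual_def by blast
  also have "\<dots> \<longleftrightarrow> (\<forall>x y. fm_ultra x \<and> x \<in> canon_comp x e \<and> fm_ultra y \<and> y \<in> canon_comp y e \<and>
      canon_dual r \<in> canon_comp x y \<longrightarrow> F \<in> canon_dual x \<or> G \<in> canon_dual y)" (is "_ \<longleftrightarrow> ?R")
  proof
    assume R: ?R
    show "Star (MNeg F) (MNeg G) \<notin> canon_dual r"
    proof
      assume "Star (MNeg F) (MNeg G) \<in> canon_dual r"
      then obtain x y where "fm_ultra x" "fm_ultra y" "MNeg F \<in> x" "MNeg G \<in> y"
        "canon_dual r \<in> canon_comp x y"
        using fm_ultra_Star_witnesses dual by blast
      then show False
        using R factor_in_component[OF dual(2)] canon_comp_comm
        unfolding canon_dual_def by blast
    qed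
  qed (auto simp: canon_comp_def canon_dual_def)
  finally show ?case
    using Par.IH fm_ultra_canon_dual canon_dual_in_component by auto
next
  case (Wand F G)
  have dual: "fm_ultra (canon_dual r)" "canon_dual r \<in> canon_comp (canon_dual r) e"
    using Wand.prems fm_ultra_canon_dual canon_dual_in_component by blast+
  have "Wand F G \<in> r \<longleftrightarrow> (\<forall>x y. fm_ultra x \<and> x \<in> canon_comp x e \<and> fm_ultra y \<and>
      y \<in> canon_comp y e \<and> y \<in> canon_comp r x \<and> F \<in> x \<longrightarrow> G \<in> y)" (is "_ \<longleftrightarrow> ?R")
  proof
    assume W: "Wand F G \<in> r"
    have "Star (Wand F G) F \<preceq> G" using entails_Wand entails_refl by blast
    then show ?R using W fm_ultra_up unfolding canon_comp_def by blast
  next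
    assume R: ?R
    show "Wand F G \<in> r"
    proof (rule ccontr)
      assume "Wand F G \<notin> r"
      then have "Star F (MNeg G) \<in> canon_dual r"
        using fm_ultra_up[OF Wand.prems(1)] entails_Wand_MNeg unfolding canon_dual_def by blast
      then obtain x s where xs: "fm_ultra x" "fm_ultra s" "F \<in> x" "MNeg G \<in> s"
        "canon_dual r \<in> canon_comp x s"
        using fm_ultra_Star_witnesses dual by blast
      then have "x \<in> canon_comp x e" "s \<in> canon_comp s e"
        using factor_in_component[OF dual(2)] canon_comp_comm by blast+
      \<comment> \<open>Rotation turns the splitting of \<open>canon_dual r\<close> into a pair
        \<open>x\<close>, \<open>canon_dual s\<close> that refutes \<open>Wand F G\<close> at
        \<open>r\<close>.\<close>
      moreover have "canon_dual s \<in> canon_comp r x"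
        using canon_comp_rotate xs Wand.prems by blast
      ultimately have "G \<in> canon_dual s"
        using R xs fm_ultra_canon_dual canon_dual_in_component by blast
      then show False using xs by (simp add: canon_dual_def)
    qed
  qed
  then show ?case using Wand by auto
qed (simp_all add: fm_ultra_simps)

end

text \<open>If \<open>F\<close> does not entail \<open>G\<close>, some ultrafilter separates them,
  and the component of its own unit is a countermodel.\<close>

lemma entails_if_valid:
  assumes "cbi_valid (Imp F G)"
  shows "F \<preceq> G"
proof (rule ccontr)
  assume "\<not> F \<preceq> G"
  then have "{B. F \<preceq> B} \<inter> {B. B \<preceq> G} = {}"
    using entails_trans by blast
  then obtain x where x: "fm_ultra x" "{B. F \<preceq> B} \<subseteq> x" "x \<inter> {B. B \<preceq> G} = {}"
    using fm_ultra_extension[OF fm_filter_principal fm_ideal_principal] by blast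
  obtain e where e: "fm_ultra e" "MTop \<in> e" "x \<in> canon_comp x e"
    using canon_unit_exists x(1) by blast
  define \<rho> where "\<rho> = (\<lambda>p. {x \<in> worlds (canon_model e). Atom p \<in> x})"
  have "\<forall>p. \<rho> p \<subseteq> worlds (canon_model e)" "x \<in> worlds (canon_model e)"
    using x(1) e(3) by (auto simp: \<rho>_def)
  \<comment> \<open>The worlds are sets of formulas, so the model lives over the very type that
    \<open>cbi_valid\<close> quantifies over.\<close>
  moreover have "true_in (canon_model e) (Imp F G)"
    using assms cbi_model_canon_model[OF e(1,2)] by (simp add: cbi_valid_def)
  ultimately have "sat (canon_model e) \<rho> x (Imp F G)"
    unfolding true_in_def by blast
  then have "Imp F G \<in> x"
    unfolding \<rho>_def sat_canon_model[OF e(1,2) x(1) e(3)] .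
  then show False
    using fm_ultra_simps(6)[OF x(1)] x(2,3) entails_refl by blast
qed

theorem theorem3p12:
  fixes X Y :: struct
  assumes "consecution_valid (X \<turnstile> Y)"
  shows "provable (X \<turnstile> Y)"
  using assms by (simp add: entails_if_valid provable_if_entails)

end
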